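(* Let $\Gamma$ be a distance-regular graph with intersection array $\{80,54,12;1,6,60\}$. Let $x$ be a vertex of $\Gamma$ and let $\Delta:=\Delta(x)$ be the local graph at $x$. Then $\Delta$ contains $4$ (pairwise) disjoint cliques with $20$ vertices each.
   Context: All graphs are finite, undirected and simple. A connected graph $\Gamma$ of diameter $D$ is distance-regular with intersection array $\{b_0,\ldots,b_{D-1};c_1,\ldots,c_D\}$ if for every $i\in\{0,\ldots,D\}$ and every pair of vertices $x,y$ at distance $i$, the number of neighbors of $y$ at distance $i-1$ from $x$ equals $c_i$ and the number of neighbors of $y$ at distance $i+1$ from $x$ equals $b_i$ (with $c_0=b_D=0$). The local graph $\Delta(x)$ at a vertex $x$ is the subgraph of $\Gamma$ induced on the neighbors of $x$ (here it has $80$ vertices). A clique is a set of pairwise adjacent vertices. *)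

theory Defs
  imports "Graph_Theory.Graph_Theory"
begin

text \<open>
  A finite undirected simple graph is the locale \<^locale>\<open>graph\<close> of the Graph-Theory entry: each edge
  is represented by its two opposite arcs, so \<open>dominates G u v\<close> is adjacency of \<open>u\<close> and \<open>v\<close>.
  With unit weights, \<open>wf_digraph.\<mu>\<close> is the infimum of the lengths of the walks from \<open>u\<close> to \<open>v\<close>.
\<close>

definition graph_distance :: "('a, 'b) pre_digraph \<Rightarrow> 'a \<Rightarrow> 'a \<Rightarrow> ereal" where
  "graph_distance G u v = wf_digraph.\<mu> G (\<lambda>_. 1) u v"

definition graph_diameter :: "('a, 'b) pre_digraph \<Rightarrow> ereal" where
  "graph_diameter G = (SUP u\<in>verts G. SUP v\<in>verts G. graph_distance G u v)"

definition neighbours :: "('a, 'b) pre_digraph \<Rightarrow> 'a \<Rightarrow> 'a set" where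
  "neighbours G x = {y \<in> verts G. dominates G x y}"

text \<open>
  The intersection array \<open>{b\<^sub>0, \<dots>, b\<^sub>D\<^sub>-\<^sub>1; c\<^sub>1, \<dots>, c\<^sub>D}\<close> is given by the lists
  \<open>bs = [b\<^sub>0, \<dots>, b\<^sub>D\<^sub>-\<^sub>1]\<close> and \<open>cs = [c\<^sub>1, \<dots>, c\<^sub>D]\<close>; appending and prepending \<open>0\<close> encodes
  the conventions \<open>b\<^sub>D = 0\<close> and \<open>c\<^sub>0 = 0\<close>. Distances are extended reals, so for \<open>i = 0\<close> the
  distance \<open>i - 1\<close> below is \<open>-1\<close> and is not attained.
\<close>

definition distance_regular :: "('a, 'b) pre_digraph \<Rightarrow> nat list \<Rightarrow> nat list \<Rightarrow> bool" where
  "distance_regular G bs cs \<longleftrightarrow>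
     graph G \<and> connected G \<and>
     graph_diameter G = ereal (real (length bs)) \<and> length cs = length bs \<and>
     (\<forall>i \<le> length bs. \<forall>x \<in> verts G. \<forall>y \<in> verts G.
        graph_distance G x y = ereal (real i) \<longrightarrow>
        card {z \<in> neighbours G y. graph_distance G x z = ereal (real i - 1)} = (0 # cs) ! i \<and>
        card {z \<in> neighbours G y. graph_distance G x z = ereal (real i + 1)} = (bs @ [0]) ! i)"

definition local_graph :: "('a, 'b) pre_digraph \<Rightarrow> 'a \<Rightarrow> ('a, 'b) pre_digraph" where
  "local_graph G x = induce_subgraph G (neighbours G x)"

definition clique_in :: "('a, 'b) pre_digraph \<Rightarrow> 'a set \<Rightarrow> bool" where
  "clique_in G K \<longleftrightarrow> K \<subseteq> verts G \<and> pairwise (dominates G) K"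

end

theory Submission
  imports Defs
begin

text \<open>
  The graph has the eigenvalue \<open>-4\<close>, so by Delsarte's bound a clique of the local graph \<open>\<Delta>\<close> has at most
  \<open>20\<close> vertices, and in the case of equality every other vertex of \<open>\<Delta>\<close> has exactly two neighbours
  in it. The rest of the argument only uses that \<open>\<Delta>\<close> is \<open>25\<close>-regular on \<open>80\<close> vertices and that
  nonadjacent vertices have at most \<open>c\<^sub>2 - 1 = 5\<close> common neighbours in \<open>\<Delta>\<close>.

  Let \<open>f z\<close> count the members of a coclique \<open>Y\<close> that are equal or adjacent to \<open>z\<close>. Double counting
  bounds the sum of \<open>(f z - 1) (f z - 2)\<close>, which is nonnegative: \<open>|Y| = 6\<close> is impossible, and for \<open>|Y| = 5\<close>
  every bound is attained. A parity argument in this rigid situation yields, in every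
  triple of \<open>Y\<close>, two members whose common neighbours include a vertex adjacent to everything that
  the other three members of \<open>Y\<close> leave uncovered; two such vertices for disjoint pairs would force a
  degree above \<open>25\<close>. Hence cocliques have at most four vertices.

  For a coclique \<open>Y\<close> of size four, the vertices seen only by \<open>y \<in> Y\<close> form a clique of size at
  least \<open>11\<close>, which lies in a unique maximal clique, the line of \<open>y\<close>. The complement of the graph
  induced on the nonneighbours of two members of \<open>Y\<close> contains no pentagon, so at most six vertices
  lie on no line of \<open>Y\<close>, and Delsarte's bound with its equality case shows that there are none.
  Four cliques of size at most \<open>20\<close> cover \<open>80\<close> vertices only if they are disjoint of size \<open>20\<close>.
\<close>

section \<open>Cocliques of the local graph\<close>

text \<open>The handshake lemma: a new vertex \<open>t\<close> adds its degree into \<open>T\<close>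
  twice, once for itself and once spread over its neighbours.\<close>

lemma even_sum_card_symmetric:
  assumes "finite T"
    and irrefl: "\<And>v. v \<notin> N v" and sym: "\<And>u v. u \<in> N v \<Longrightarrow> v \<in> N u"
  shows "even (\<Sum>u\<in>T. card (N u \<inter> T))"
  using assms(1)
proof (induction T rule: finite_induct)
  case (insert t T)
  have sym': "u \<in> N v \<longleftrightarrow> v \<in> N u" for u v
    using sym by blast
  have "(\<Sum>u\<in>T. card (N u \<inter> insert t T)) = (\<Sum>u\<in>T. card (N u \<inter> T) + (if t \<in> N u then 1 else 0))"
    using insert.hyps by (intro sum.cong) auto
  also have "\<dots> = (\<Sum>u\<in>T. card (N u \<inter> T)) + card (N t \<inter> T)"
    using insert.hyps by (simp add: sum.distrib sum.If_cases sym'[of t] Int_def conj_commute)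
  finally have "(\<Sum>u\<in>insert t T. card (N u \<inter> insert t T)) = (\<Sum>u\<in>T. card (N u \<inter> T)) + 2 * card (N t \<inter> T)"
    using insert.hyps irrefl[of t] by simp
  with insert.IH show ?case by simp
qed simp

text \<open>The Delsarte bound and its equality case enter as the last two assumptions, so that this
  half of the argument is purely combinatorial.\<close>

locale local_graph_80 =
  fixes V :: "'a set" and N :: "'a \<Rightarrow> 'a set"
  assumes finite_V: "finite V" and card_V: "card V = 80"
    and N_subset: "N v \<subseteq> V"
    and N_irrefl: "v \<notin> N v"
    and N_sym: "u \<in> N v \<Longrightarrow> v \<in> N u"
    and card_N: "v \<in> V \<Longrightarrow> card (N v) = 25"
    and card_common: "\<lbrakk>u \<in> V; v \<in> V; u \<noteq> v; v \<notin> N u\<rbrakk> \<Longrightarrow> card (N u \<inter> N v) \<le> 5"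
    and clique_le_20: "\<lbrakk>K \<subseteq> V; \<And>u v. \<lbrakk>u \<in> K; v \<in> K; u \<noteq> v\<rbrakk> \<Longrightarrow> v \<in> N u\<rbrakk> \<Longrightarrow> card K \<le> 20"
    and clique_20_tight: "\<lbrakk>K \<subseteq> V; \<And>u v. \<lbrakk>u \<in> K; v \<in> K; u \<noteq> v\<rbrakk> \<Longrightarrow> v \<in> N u; card K = 20; w \<in> V - K\<rbrakk>
      \<Longrightarrow> card (N w \<inter> K) = 2"
begin

text \<open>With closed neighbourhoods a member of a coclique counts itself. For distinct
  nonadjacent vertices the closed neighbourhoods meet exactly where the open ones do.\<close>

definition nbh :: "'a \<Rightarrow> 'a set" where
  "nbh v = insert v (N v)"

definition coclique :: "'a set \<Rightarrow> bool" where
  "coclique Y \<longleftrightarrow> Y \<subseteq> V \<and> (\<forall>u\<in>Y. \<forall>v\<in>Y. u \<noteq> v \<longrightarrow> v \<notin> N u)"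

definition clique :: "'a set \<Rightarrow> bool" where
  "clique K \<longleftrightarrow> K \<subseteq> V \<and> (\<forall>u\<in>K. \<forall>v\<in>K. u \<noteq> v \<longrightarrow> v \<in> N u)"

definition hits :: "'a set \<Rightarrow> 'a \<Rightarrow> nat" where
  "hits Y z = card {y \<in> Y. z \<in> nbh y}"

definition nonnbh :: "'a set \<Rightarrow> 'a set" where
  "nonnbh S = V - (\<Union>y\<in>S. nbh y)"

lemma N_commute: "u \<in> N v \<longleftrightarrow> v \<in> N u"
  using N_sym by blast

lemma nbh_commute: "u \<in> nbh v \<longleftrightarrow> v \<in> nbh u"
  using N_sym by (auto simp: nbh_def)

lemma finite_N [simp]: "finite (N v)"
  using N_subset finite_V finite_subset by blast

lemma finite_nbh [simp]: "finite (nbh v)"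
  by (simp add: nbh_def)

lemma card_nbh: "v \<in> V \<Longrightarrow> card (nbh v) = 26"
  by (simp add: nbh_def card_N N_irrefl)

lemma nbh_subset: "v \<in> V \<Longrightarrow> nbh v \<subseteq> V"
  using N_subset by (auto simp: nbh_def)

lemma nbh_refl [simp]: "v \<in> nbh v"
  by (simp add: nbh_def)

lemma finite_nonnbh [simp]: "finite (nonnbh S)"
  by (simp add: nonnbh_def finite_V)

lemma nonnbh_iff: "z \<in> nonnbh S \<longleftrightarrow> z \<in> V \<and> (\<forall>y\<in>S. z \<notin> nbh y)"
  by (auto simp: nonnbh_def)

lemma nonnbh_insert: "nonnbh (insert y S) = nonnbh S - nbh y"
  by (auto simp: nonnbh_def)

lemma card_common_nbh:
  assumes "u \<in> V" "v \<in> V" "v \<notin> nbh u"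
  shows "card (nbh u \<inter> nbh v) \<le> 5"
proof -
  have "nbh u \<inter> nbh v = N u \<inter> N v"
    using assms(3) N_commute by (auto simp: nbh_def)
  then show ?thesis
    using card_common[of u v] assms by (auto simp: nbh_def)
qed

lemma coclique_iff: "coclique Y \<longleftrightarrow> Y \<subseteq> V \<and> (\<forall>u\<in>Y. \<forall>v\<in>Y. u \<noteq> v \<longrightarrow> v \<notin> nbh u)"
  by (auto simp: coclique_def nbh_def)

lemma clique_iff: "clique K \<longleftrightarrow> K \<subseteq> V \<and> (\<forall>u\<in>K. \<forall>v\<in>K. v \<in> nbh u)"
  by (auto simp: clique_def nbh_def)

lemma coclique_finite: "coclique Y \<Longrightarrow> finite Y"
  using finite_V finite_subset by (auto simp: coclique_def)

lemma coclique_subset: "coclique Y \<Longrightarrow> S \<subseteq> Y \<Longrightarrow> coclique S"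
  by (auto simp: coclique_def)

lemma coclique_insert: "coclique (insert y Y) \<longleftrightarrow> y \<in> V \<and> coclique Y \<and> (\<forall>v\<in>Y. v \<noteq> y \<longrightarrow> v \<notin> nbh y)"
  using nbh_commute by (auto simp: coclique_iff)

lemma coclique_insert_nonnbh: "coclique Y \<Longrightarrow> z \<in> nonnbh Y \<Longrightarrow> coclique (insert z Y)"
  using nbh_commute by (auto simp: coclique_insert nonnbh_iff)

lemma hits_eq_0_iff: "finite Y \<Longrightarrow> hits Y z = 0 \<longleftrightarrow> (\<forall>y\<in>Y. z \<notin> nbh y)"
  by (auto simp: hits_def)

lemma hits_mono: "finite Y \<Longrightarrow> S \<subseteq> Y \<Longrightarrow> hits S z \<le> hits Y z"
  unfolding hits_def by (intro card_mono) auto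

section \<open>Double counting over a coclique\<close>

definition pairs_sum :: "'a set \<Rightarrow> int" where
  "pairs_sum Y = (\<Sum>u\<in>Y. \<Sum>v\<in>Y - {u}. int (card (nbh u \<inter> nbh v)))"

text \<open>Expanding the product leaves two moments of \<open>hits Y\<close>: the first is 26 |Y|,
  the second is 26 |Y| plus the sum over ordered pairs. The constants are 2 * 80 = 160 and 26 - 3 *
  26 = -52.\<close>

lemma sum_hits_quadratic:
  assumes "coclique Y"
  shows "(\<Sum>z\<in>V. (int (hits Y z) - 1) * (int (hits Y z) - 2)) = 160 - 52 * int (card Y) + pairs_sum Y"
proof -
  note [simp] = coclique_finite[OF assms] finite_V
  have YV: "Y \<subseteq> V" using assms by (simp add: coclique_def)
  have hits: "int (hits Y z) = (\<Sum>y\<in>Y. of_bool (z \<in> nbh y))" for z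
    by (simp add: hits_def of_bool_def sum.If_cases Int_def)
  have single: "(\<Sum>z\<in>V. of_bool (z \<in> nbh u \<and> z \<in> nbh v)) = int (card (nbh u \<inter> nbh v))" if "u \<in> Y" for u v
  proof -
    have "V \<inter> {z. z \<in> nbh u \<and> z \<in> nbh v} = nbh u \<inter> nbh v"
      using nbh_subset that YV by auto
    then show ?thesis by (simp add: of_bool_def sum.If_cases)
  qed
  have s1: "(\<Sum>z\<in>V. int (hits Y z)) = 26 * int (card Y)"
  proof -
    have "(\<Sum>z\<in>V. int (hits Y z)) = (\<Sum>y\<in>Y. \<Sum>z\<in>V. of_bool (z \<in> nbh y \<and> z \<in> nbh y))"
      unfolding hits by (subst sum.swap) simp
    also have "\<dots> = (\<Sum>y\<in>Y. 26)"
      using YV by (intro sum.cong refl) (subst single, auto simp: card_nbh)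
    finally show ?thesis by simp
  qed
  have s2: "(\<Sum>z\<in>V. int (hits Y z) ^ 2) = 26 * int (card Y) + pairs_sum Y"
  proof -
    have "(\<Sum>z\<in>V. int (hits Y z) ^ 2) = (\<Sum>z\<in>V. \<Sum>u\<in>Y. \<Sum>v\<in>Y. of_bool (z \<in> nbh u \<and> z \<in> nbh v))"
      unfolding hits power2_eq_square sum_product by (intro sum.cong refl) auto
    also have "\<dots> = (\<Sum>u\<in>Y. \<Sum>z\<in>V. \<Sum>v\<in>Y. of_bool (z \<in> nbh u \<and> z \<in> nbh v))"
      by (rule sum.swap)
    also have "\<dots> = (\<Sum>u\<in>Y. \<Sum>v\<in>Y. \<Sum>z\<in>V. of_bool (z \<in> nbh u \<and> z \<in> nbh v))"
      by (rule sum.cong[OF refl], rule sum.swap)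
    also have "\<dots> = (\<Sum>u\<in>Y. \<Sum>v\<in>Y. int (card (nbh u \<inter> nbh v)))"
      by (intro sum.cong refl single)
    also have "\<dots> = (\<Sum>u\<in>Y. 26 + (\<Sum>v\<in>Y - {u}. int (card (nbh u \<inter> nbh v))))"
      using YV by (intro sum.cong refl) (subst sum.remove, auto simp: card_nbh)
    finally show ?thesis by (simp add: sum.distrib pairs_sum_def)
  qed
  have "(\<Sum>z\<in>V. (int (hits Y z) - 1) * (int (hits Y z) - 2))
      = (\<Sum>z\<in>V. int (hits Y z) ^ 2 - 3 * int (hits Y z) + 2)"
    by (intro sum.cong refl) (simp add: power2_eq_square algebra_simps)
  also have "\<dots> = (\<Sum>z\<in>V. int (hits Y z) ^ 2) - 3 * (\<Sum>z\<in>V. int (hits Y z)) + 160"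
    by (simp add: sum.distrib sum_subtractf sum_distrib_left card_V)
  finally show ?thesis using s1 s2 by simp
qed

lemma pairs_sum_le:
  assumes "coclique Y"
  shows "pairs_sum Y \<le> 5 * int (card Y) * (int (card Y) - 1)"
proof -
  have "pairs_sum Y \<le> (\<Sum>u\<in>Y. \<Sum>v\<in>Y - {u}. 5)"
    unfolding pairs_sum_def
    using assms by (intro sum_mono) (auto simp: coclique_iff subset_iff intro: card_common_nbh)
  also have "\<dots> = 5 * int (card Y) * (int (card Y) - 1)"
    using coclique_finite[OF assms] by (cases "Y = {}") (auto simp: of_nat_diff card_gt_0_iff Suc_le_eq)
  finally show ?thesis .
qed

lemma quadratic_nonneg: "(int n - 1) * (int n - 2) \<ge> 0"
  by (cases "n \<le> 1") (auto intro: mult_nonpos_nonpos)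

lemma coclique_card_le_5:
  assumes "coclique Y"
  shows "card Y \<le> 5"
proof (rule ccontr)
  assume "\<not> card Y \<le> 5"
  then obtain Z where Z: "Z \<subseteq> Y" "card Z = 6"
    using obtain_subset_with_card_n[of 6 Y] by auto
  then have iZ: "coclique Z" using assms coclique_subset by blast
  \<comment> \<open>At size six the sum would be at most 160 - 312 + 150 = -2.\<close>
  have "0 \<le> (\<Sum>z\<in>V. (int (hits Z z) - 1) * (int (hits Z z) - 2))"
    by (intro sum_nonneg quadratic_nonneg)
  with sum_hits_quadratic[OF iZ] pairs_sum_le[OF iZ] Z(2) show False by simp
qed

section \<open>Rigidity of cocliques of size five\<close>

lemma
  assumes "coclique Y" "card Y = 5"
  shows hits_5: "z \<in> V \<Longrightarrow> hits Y z = 1 \<or> hits Y z = 2"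
    and common_5: "\<lbrakk>u \<in> Y; v \<in> Y; u \<noteq> v\<rbrakk> \<Longrightarrow> card (nbh u \<inter> nbh v) = 5"
proof -
  note fin [simp] = coclique_finite[OF assms(1)] 
  have le: "card (nbh u \<inter> nbh v) \<le> 5" if "u \<in> Y" "v \<in> Y" "u \<noteq> v" for u v
    using assms(1) that by (auto simp: coclique_iff intro: card_common_nbh)
  have nn: "0 \<le> (\<Sum>z\<in>V. (int (hits Y z) - 1) * (int (hits Y z) - 2))"
    by (intro sum_nonneg quadratic_nonneg)
  have ub: "pairs_sum Y \<le> 100" using pairs_sum_le[OF assms(1)] assms(2) by simp
  \<comment> \<open>At size five the upper bound is 160 - 260 + 100 = 0, so every summand vanishes
    and every pair has to attain the bound 5.\<close>
  have z: "(\<Sum>z\<in>V. (int (hits Y z) - 1) * (int (hits Y z) - 2)) = 0" and P: "pairs_sum Y = 100"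
    using sum_hits_quadratic[OF assms(1)] assms(2) nn ub by simp_all
  show "hits Y z = 1 \<or> hits Y z = 2" if "z \<in> V"
    using z sum_nonneg_eq_0_iff[OF finite_V quadratic_nonneg, of "hits Y"] that by auto
  show "card (nbh u \<inter> nbh v) = 5" if uv: "u \<in> Y" "v \<in> Y" "u \<noteq> v"
  proof (rule ccontr)
    assume "card (nbh u \<inter> nbh v) \<noteq> 5"
    then have lt: "card (nbh u \<inter> nbh v) < 5" using le[OF uv] by simp
    have "(\<Sum>v\<in>Y - {u}. int (card (nbh u \<inter> nbh v))) < (\<Sum>v\<in>Y - {u}. 5)"
      using uv lt by (intro sum_strict_mono_ex1) (force intro: le)+
    moreover have "(\<Sum>v\<in>Y - {w}. int (card (nbh w \<inter> nbh v))) \<le> (\<Sum>v\<in>Y - {w}. 5)" if "w \<in> Y" for w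
      using that le by (intro sum_mono) auto
    ultimately have "pairs_sum Y < (\<Sum>u\<in>Y. \<Sum>v\<in>Y - {u}. 5)"
      unfolding pairs_sum_def using uv by (intro sum_strict_mono_ex1) auto
    also have "\<dots> = 100" using assms(2) by simp
    finally show False using P by simp
  qed
qed

text \<open>On \<open>S\<close> the value of \<open>hits\<close> stays at most 2, so the product is
  2 at the uncovered vertices and 0 elsewhere. For |S| = 2, 3, 4 this leaves 33, 17 and 6 uncovered
  vertices.\<close>

lemma card_nonnbh_5:
  assumes "coclique Y" "card Y = 5" "S \<subseteq> Y"
  shows "2 * int (card (nonnbh S)) = 160 - 52 * int (card S) + 5 * int (card S) * (int (card S) - 1)"
proof -
  have iS: "coclique S" and fS: "finite S"
    using assms coclique_subset coclique_finite by blast+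
  have "pairs_sum S = (\<Sum>u\<in>S. \<Sum>v\<in>S - {u}. 5)"
    unfolding pairs_sum_def using common_5[OF assms(1,2)] assms(3) by (intro sum.cong refl) auto
  also have "\<dots> = 5 * int (card S) * (int (card S) - 1)"
    using fS by (cases "S = {}") (auto simp: of_nat_diff card_gt_0_iff Suc_le_eq)
  finally have P: "pairs_sum S = 5 * int (card S) * (int (card S) - 1)" .
  have "(\<Sum>z\<in>V. (int (hits S z) - 1) * (int (hits S z) - 2)) = (\<Sum>z\<in>V. if z \<in> nonnbh S then 2 else 0)"
  proof (intro sum.cong refl)
    fix z assume "z \<in> V"
    have "hits S z \<le> hits Y z"
      using assms(3) coclique_finite[OF assms(1)] by (intro hits_mono)
    then have "hits S z = 0 \<or> hits S z = 1 \<or> hits S z = 2"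
      using hits_5[OF assms(1,2) \<open>z \<in> V\<close>] by auto
    then show "(int (hits S z) - 1) * (int (hits S z) - 2) = (if z \<in> nonnbh S then 2 else 0)"
      using hits_eq_0_iff[OF fS, of z] \<open>z \<in> V\<close> by (auto simp: nonnbh_iff)
  qed
  also have "\<dots> = 2 * int (card (nonnbh S))"
    by (simp add: sum.If_cases finite_V nonnbh_def Int_absorb1 Diff_subset Int_def set_diff_eq)
  finally show ?thesis using sum_hits_quadratic[OF iS] P by simp
qed

section \<open>Dominating vertices and the exclusion of cocliques of size five\<close>

definition dominating :: "'a \<Rightarrow> 'a set \<Rightarrow> 'a set \<Rightarrow> bool" where
  "dominating d P R \<longleftrightarrow> d \<in> V \<and> (\<forall>y\<in>P. d \<in> nbh y) \<and> (\<forall>y\<in>R. d \<notin> nbh y) \<and> nonnbh R \<subseteq> nbh d"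

lemma card_nbh_Int_nonnbh:
  assumes "coclique (insert u R)" "u \<notin> R" "insert u R \<subseteq> Z" "coclique Z" "card Z = 5" "card R = 2"
  shows "card (nbh u \<inter> nonnbh R) = 16"
proof -
  have "finite R" using assms(1) coclique_finite by fastforce
  have "card (nonnbh R) = 33"
    using card_nonnbh_5[of Z R] assms by auto
  moreover have "card (nonnbh (insert u R)) = 17"
    using card_nonnbh_5[of Z "insert u R"] assms \<open>finite R\<close> by auto
  moreover have "card (nonnbh R) = card (nonnbh (insert u R)) + card (nbh u \<inter> nonnbh R)"
    unfolding nonnbh_insert by (subst card_Un_disjoint[symmetric]) (auto intro: arg_cong[where f=card])
  ultimately show ?thesis by simp
qed

text \<open>
  Let \<open>R = Y - S\<close>. A vertex of \<open>nonnbh R\<close> that extends \<open>R\<close> to a coclique of size five has \<open>15\<close>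
  neighbours in \<open>nonnbh R\<close>. As \<open>33 * 15\<close> is odd, this cannot hold for all \<open>33\<close> vertices.
\<close>

lemma ex_dominating:
  assumes "coclique Y" "card Y = 5" "S \<subseteq> Y" "card S = 3"
  shows "\<exists>a\<in>S. \<exists>b\<in>S. \<exists>d. a \<noteq> b \<and> dominating d {a, b} (Y - {a, b})"
proof -
  note fin [simp] = coclique_finite[OF assms(1)]
  define R where "R = Y - S"
  have finR [simp]: "finite R" and RY: "R \<subseteq> Y" and cR: "card R = 2"
    using assms finite_subset[OF assms(3)] by (auto simp: R_def card_Diff_subset)
  define good where "good u \<longleftrightarrow> (\<exists>Z. coclique Z \<and> card Z = 5 \<and> insert u R \<subseteq> Z)" for u
  have cT: "card (nonnbh R) = 33"
    using card_nonnbh_5[OF assms(1,2) RY] cR by simp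
  have "\<exists>d\<in>nonnbh R. \<not> good d"
  proof (rule ccontr)
    assume "\<not> (\<exists>d\<in>nonnbh R. \<not> good d)"
    then have g: "good u" if "u \<in> nonnbh R" for u using that by blast
    have "card (N u \<inter> nonnbh R) = 15" if u: "u \<in> nonnbh R" for u
    proof -
      obtain Z where Z: "coclique Z" "card Z = 5" "insert u R \<subseteq> Z" using g[OF u] good_def by blast
      have "u \<notin> R" using u by (auto simp: nonnbh_iff)
      then have "card (nbh u \<inter> nonnbh R) = 16"
        using card_nbh_Int_nonnbh[of u R Z] Z cR coclique_subset by blast
      moreover have "nbh u \<inter> nonnbh R = insert u (N u \<inter> nonnbh R)" using u by (auto simp: nbh_def)
      ultimately show ?thesis using N_irrefl by simp
    qed
    then have "(\<Sum>u\<in>nonnbh R. card (N u \<inter> nonnbh R)) = 33 * 15" using cT by simp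
    with even_sum_card_symmetric[of "nonnbh R" N] N_irrefl N_sym show False
      by simp
  qed
  then obtain d where d: "d \<in> nonnbh R" "\<not> good d" by blast
  have dV: "d \<in> V" using d by (simp add: nonnbh_iff)
  have dY: "d \<notin> Y"
    using d assms RY by (auto simp: good_def)
  have sub: "{y \<in> Y. d \<in> nbh y} \<subseteq> S" using d by (auto simp: nonnbh_iff R_def)
  \<comment> \<open>If \<open>d\<close> sees a single member \<open>a\<close> of \<open>Y\<close>,
    then exchanging \<open>a\<close> for \<open>d\<close> gives a coclique of size five that makes
    \<open>d\<close> good.\<close>
  have "card {y \<in> Y. d \<in> nbh y} \<noteq> 1"
  proof
    assume "card {y \<in> Y. d \<in> nbh y} = 1"
    then obtain a where a: "{y \<in> Y. d \<in> nbh y} = {a}" by (auto simp: card_1_singleton_iff)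
    then have "d \<in> nonnbh (Y - {a})" "a \<in> Y" "a \<in> S" using dV sub by (auto simp: nonnbh_iff)
    then have "coclique (insert d (Y - {a}))" "card (insert d (Y - {a})) = 5" "insert d R \<subseteq> insert d (Y - {a})"
      using assms dY coclique_subset[of Y "Y - {a}"] by (auto intro!: coclique_insert_nonnbh simp: R_def)
    then show False using d(2) good_def by blast
  qed
  then have "card {y \<in> Y. d \<in> nbh y} = 2"
    using hits_5[OF assms(1,2) dV] by (simp add: hits_def)
  then obtain a b where ab: "{y \<in> Y. d \<in> nbh y} = {a, b}" "a \<noteq> b" by (auto simp: card_2_iff)
  have abS: "a \<in> S" "b \<in> S" using ab sub by auto
  have abY: "a \<in> Y" "b \<in> Y" using abS assms(3) by auto
  have dF: "d \<in> nonnbh (Y - {a, b})" using dV ab(1) by (auto simp: nonnbh_iff)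
  have "nonnbh (Y - {a, b}) \<subseteq> nbh d"
  \<comment> \<open>A vertex \<open>v\<close> missed by \<open>d\<close> could replace
    \<open>a\<close> and \<open>b\<close> together with \<open>d\<close>, which again would make
    \<open>d\<close> good.\<close>
  proof (rule subsetI, rule ccontr)
    fix v assume v: "v \<in> nonnbh (Y - {a, b})" "v \<notin> nbh d"
    let ?Z = "insert v (insert d (Y - {a, b}))"
    have "v \<notin> Y - {a, b}" "v \<noteq> d" using v nbh_refl[of v] unfolding nonnbh_iff by blast+
    then have "card ?Z = 5" using dY assms abY ab(2) by (simp add: card_Diff_subset)
    moreover have "coclique ?Z"
      using v dF coclique_insert_nonnbh[OF coclique_subset[OF assms(1), of "Y - {a, b}"] dF]
      by - (rule coclique_insert_nonnbh, auto simp: nonnbh_insert)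
    moreover have "insert d R \<subseteq> ?Z" using abS by (auto simp: R_def)
    ultimately show False using d(2) good_def by blast
  qed
  then have "dominating d {a, b} (Y - {a, b})"
    using dV ab(1) by (auto simp: dominating_def)
  then show ?thesis using abS ab(2) by blast
qed

text \<open>\<open>W\<close> is the part of \<open>nonnbh {e, f}\<close> missed by \<open>d\<close>.
  It is a clique containing the six vertices of \<open>nonnbh {a, b, e, f}\<close>, all of which
  \<open>d'\<close> sees. A member of \<open>W\<close> missed by \<open>d'\<close> would thus share
  six neighbours with \<open>d'\<close>, one more than allowed.\<close>

lemma dominating_clique:
  assumes Y: "coclique {a, b, c, e, f}" "distinct [a, b, c, e, f]"
    and d: "dominating d {a, b} {c, e, f}" and d': "dominating d' {c, e} {a, b, f}"
  defines "W \<equiv> nonnbh {e, f} - nbh d"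
  shows "card W + card (nbh d \<inter> nonnbh {e, f}) = 33" "W \<subseteq> nbh d'" "card (W \<inter> nonnbh {a, b, f}) \<le> 6"
proof -
  have c5: "card {a, b, c, e, f} = 5" using Y(2) by simp
  note cF = card_nonnbh_5[OF Y(1) c5]
  have cards: "card (nonnbh {e, f}) = 33" "card (nonnbh {c, e, f}) = 17" "card (nonnbh {a, b, e, f}) = 6"
    using cF[of "{e, f}"] cF[of "{c, e, f}"] cF[of "{a, b, e, f}"] Y(2) by auto
  show "card W + card (nbh d \<inter> nonnbh {e, f}) = 33"
    unfolding W_def cards(1)[symmetric]
    by (subst card_Un_disjoint[symmetric]) (auto intro: arg_cong[where f=card])
  have "W \<inter> nonnbh {a, b, f} \<subseteq> nonnbh {a, b, e, f}" by (auto simp: W_def nonnbh_iff)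
  then show "card (W \<inter> nonnbh {a, b, f}) \<le> 6"
    using card_mono[of "nonnbh {a, b, e, f}"] cards(3) by simp
  \<comment> \<open>Nonadjacent \<open>w\<close> and \<open>w'\<close> would complete
    \<open>d\<close>, \<open>e\<close>, \<open>f\<close> to a coclique of size five. Then
    \<open>d\<close> sees exactly 16 vertices of \<open>nonnbh {e, f}\<close>, but by domination it
    sees the 17 of \<open>nonnbh {c, e, f}\<close>.\<close>
  have cl: "w' \<in> nbh w" if w: "w \<in> W" "w' \<in> W" for w w'
  proof (rule ccontr)
    assume nb: "w' \<notin> nbh w"
    have dF: "d \<in> nonnbh {e, f}" using d by (auto simp: dominating_def nonnbh_iff)
    have i: "coclique (insert d {e, f})"
      using coclique_insert_nonnbh[OF coclique_subset[OF Y(1), of "{e, f}"] dF] by auto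
    have "coclique (insert w (insert d {e, f}))"
      using i w by - (rule coclique_insert_nonnbh, auto simp: W_def nonnbh_insert)
    then have iZ: "coclique (insert w' (insert w (insert d {e, f})))"
      using w nb by - (rule coclique_insert_nonnbh, auto simp: W_def nonnbh_insert)
    moreover have "card (insert w' (insert w (insert d {e, f}))) = 5"
    proof -
      have "d \<notin> {e, f}" "w \<notin> {d, e, f}" "w' \<notin> {w, d, e, f}"
        using dF w nb by (auto simp: W_def nonnbh_iff)
      then show ?thesis using Y(2) by simp
    qed
    ultimately have "card (nbh d \<inter> nonnbh {e, f}) = 16"
      using i dF Y(2) by (intro card_nbh_Int_nonnbh[of d "{e, f}"]) (auto simp: nonnbh_iff)
    moreover have "nonnbh {c, e, f} \<subseteq> nbh d \<inter> nonnbh {e, f}" using d by (auto simp: dominating_def nonnbh_iff)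
    then have "17 \<le> card (nbh d \<inter> nonnbh {e, f})" using card_mono[of "nbh d \<inter> nonnbh {e, f}" "nonnbh {c, e, f}"] cards(2) by auto
    ultimately show False by simp
  qed
  \<comment> \<open>Exchanging \<open>c\<close> for \<open>k\<close> gives another coclique of size
    five; if \<open>d\<close> saw \<open>k\<close>, it would be hit three times, by
    \<open>k\<close>, \<open>a\<close> and \<open>b\<close>.\<close>
  have KW: "nonnbh {a, b, e, f} \<subseteq> W"
  proof
    fix k assume k: "k \<in> nonnbh {a, b, e, f}"
    have "k \<notin> nbh d"
    proof
      assume "k \<in> nbh d"
      let ?Z = "insert k {a, b, e, f}"
      have nk: "k \<notin> {a, b, e, f}" using k by (auto simp: nonnbh_iff)
      have iZ: "coclique ?Z"
        using k coclique_subset[OF Y(1), of "{a, b, e, f}"] by - (rule coclique_insert_nonnbh, auto)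
      moreover have "card ?Z = 5" using nk Y(2) by simp
      ultimately have "hits ?Z d \<le> 2" using hits_5[of ?Z d] d by (auto simp: dominating_def)
      moreover have "{k, a, b} \<subseteq> {y \<in> ?Z. d \<in> nbh y}"
        using d \<open>k \<in> nbh d\<close> nbh_commute by (auto simp: dominating_def)
      then have "card {k, a, b} \<le> hits ?Z d"
        unfolding hits_def by (intro card_mono) auto
      ultimately show False using nk Y(2) by simp
    qed
    then show "k \<in> W" using k by (auto simp: W_def nonnbh_iff)
  qed
  have Kd': "nonnbh {a, b, e, f} \<subseteq> nbh d'" using d' by (auto simp: dominating_def nonnbh_iff)
  show "W \<subseteq> nbh d'"
  proof (rule subsetI, rule ccontr)
    fix w assume w: "w \<in> W" "w \<notin> nbh d'"
    have "nonnbh {a, b, e, f} \<subseteq> nbh d' \<inter> nbh w" using Kd' KW cl[OF w(1)] by auto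
    then have "6 \<le> card (nbh d' \<inter> nbh w)" using card_mono[of "nbh d' \<inter> nbh w" "nonnbh {a, b, e, f}"] cards(3) by auto
    moreover have "card (nbh d' \<inter> nbh w) \<le> 5"
      using w d' by (intro card_common_nbh) (auto simp: dominating_def W_def nonnbh_iff)
    ultimately show False by simp
  qed
qed

text \<open>The previous lemma is used twice, with \<open>c\<close> and \<open>e\<close>
  interchanged. The resulting sets \<open>W\<close> and \<open>W'\<close> are disjoint and, together
  with the 17 vertices of \<open>nonnbh {a, b, f}\<close>, too large for the 26 vertices of
  \<open>nbh d'\<close>.\<close>

lemma no_disjoint_dominating:
  assumes Y: "coclique {a, b, c, e, f}" "distinct [a, b, c, e, f]"
    and d: "dominating d {a, b} {c, e, f}" and d': "dominating d' {c, e} {a, b, f}"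
  shows False
proof -
  define W where "W = nonnbh {e, f} - nbh d"
  define W' where "W' = nonnbh {c, f} - nbh d"
  define Q where "Q = nonnbh {c, e, f}"
  note D = dominating_clique[OF Y d d', folded W_def]
  have eq: "{a, b, e, c, f} = {a, b, c, e, f}" "{e, c, f} = {c, e, f}" "{e, c} = {c, e}" by auto
  have "coclique {a, b, e, c, f}" "distinct [a, b, e, c, f]" "dominating d {a, b} {e, c, f}" "dominating d' {e, c} {a, b, f}"
    using Y d d' by (auto simp: eq)
  note D' = dominating_clique[OF this, folded W'_def]
  have c5: "card {a, b, c, e, f} = 5" using Y(2) by simp
  have cQ: "card Q = 17" "card (nonnbh {a, b, f}) = 17"
    using card_nonnbh_5[OF Y(1) c5, of "{c, e, f}"] card_nonnbh_5[OF Y(1) c5, of "{a, b, f}"] Y(2) by (auto simp: Q_def)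
  have QB: "Q \<subseteq> nbh d" using d by (auto simp: dominating_def Q_def)
  have dV: "d \<in> V" "d' \<in> V" using d d' by (auto simp: dominating_def)
  define X where "X = nbh d \<inter> nonnbh {e, f}"
  define X' where "X' = nbh d \<inter> nonnbh {c, f}"
  have fin: "finite X" "finite X'" "finite Q" "finite W" "finite W'"
    by (auto simp: X_def X'_def Q_def W_def W'_def)
  have "X \<inter> X' = Q" using QB by (auto simp: X_def X'_def Q_def nonnbh_iff)
  then have "card X + card X' = card (X \<union> X') + 17" using card_Un_Int[of X X'] fin cQ by simp
  moreover have "card (X \<union> X') \<le> 26"
    using card_mono[of "nbh d" "X \<union> X'"] card_nbh[OF dV(1)] by (auto simp: X_def X'_def)
  \<comment> \<open>\<open>X\<close> and \<open>X'\<close> lie in \<open>nbh d\<close> and share 17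
    vertices, so their sizes add up to at most 26 + 17 = 43, and 2 * 33 - 43 = 23.\<close>
  ultimately have WW: "card W + card W' \<ge> 23" using D(1) D'(1) by (simp add: X_def X'_def)
  have "W \<inter> W' = {}" using QB by (auto simp: W_def W'_def Q_def nonnbh_iff)
  let ?G = "nonnbh {a, b, f}"
  have GB: "?G \<subseteq> nbh d'" using d' by (auto simp: dominating_def)
  have "card (W - ?G) = card W - card (W \<inter> ?G)" "card (W' - ?G) = card W' - card (W' \<inter> ?G)"
    using fin by (auto simp: card_Diff_subset_Int)
  then have "card (W - ?G) \<ge> card W - 6" "card (W' - ?G) \<ge> card W' - 6" using D(3) D'(3) by auto
  moreover have "card (?G \<union> (W - ?G) \<union> (W' - ?G)) = card ?G + card (W - ?G) + card (W' - ?G)"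
    using fin \<open>W \<inter> W' = {}\<close> by (subst card_Un_disjoint; (subst card_Un_disjoint)?) auto
  moreover have "card (?G \<union> (W - ?G) \<union> (W' - ?G)) \<le> 26"
    using card_mono[of "nbh d'" "?G \<union> (W - ?G) \<union> (W' - ?G)"] card_nbh[OF dV(2)] GB D(2) D'(2) by auto
  \<comment> \<open>The union has at least 17 + 23 - 6 - 6 = 28 vertices.\<close>
  ultimately show False using WW cQ by linarith
qed

lemma coclique_card_le_4:
  assumes "coclique Y"
  shows "card Y \<le> 4"
proof (rule ccontr)
  assume "\<not> card Y \<le> 4"
  with coclique_card_le_5[OF assms] have c5: "card Y = 5" by simp
  note fin [simp] = coclique_finite[OF assms]
  obtain S where "S \<subseteq> Y" "card S = 3" using obtain_subset_with_card_n[of 3 Y] c5 by auto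
  then obtain a b d where ab: "a \<in> Y" "b \<in> Y" "a \<noteq> b" and d: "dominating d {a, b} (Y - {a, b})"
    using ex_dominating[OF assms c5] by blast
  \<comment> \<open>The rest of \<open>Y\<close> is again a triple, so \<open>ex_dominating\<close>
    supplies a second pair disjoint from the first.\<close>
  have "card (Y - {a, b}) = 3" using ab c5 by (simp add: card_Diff_subset)
  then obtain c e d' where ce: "c \<in> Y - {a, b}" "e \<in> Y - {a, b}" "c \<noteq> e"
    and d': "dominating d' {c, e} (Y - {c, e})"
    using ex_dominating[OF assms c5, of "Y - {a, b}"] by blast
  have "card (Y - {a, b, c, e}) = card (Y - {a, b} - {c, e})" 
    by (intro arg_cong[where f=card]) auto
  also have "\<dots> = 1"
    using ce \<open>card (Y - {a, b}) = 3\<close> by (subst card_Diff_subset) auto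
  finally have "card (Y - {a, b, c, e}) = 1" .
  then obtain f where f: "Y - {a, b, c, e} = {f}" by (auto simp: card_1_singleton_iff)
  have "Y = {a, b, c, e, f}" "Y - {a, b} = {c, e, f}" "Y - {c, e} = {a, b, f}" "distinct [a, b, c, e, f]"
    using f ab ce by auto
  then show False using no_disjoint_dominating[of a b c e f d d'] assms d d' by simp
qed

section \<open>Lines of a coclique of size four\<close>

lemma card_nonnbh_pair:
  assumes "e \<in> V" "f \<in> V"
  shows "card (nonnbh {e, f}) \<ge> 28"
proof -
  have "card (nbh e \<union> nbh f) \<le> 52"
    using card_Un_le[of "nbh e" "nbh f"] card_nbh assms by simp
  moreover have "card (nonnbh {e, f}) = 80 - card (nbh e \<union> nbh f)"
    using nbh_subset assms card_V by (simp add: nonnbh_def card_Diff_subset)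
  ultimately show ?thesis by simp
qed

text \<open>
  A vertex of \<open>nonnbh {e, f}\<close> misses at most two vertices of a pentagon of nonadjacencies, while
  the two ends of a nonadjacency together are missed by all but five vertices.
\<close>

lemma no_pentagon:
  assumes ef: "coclique {e, f}" "e \<noteq> f" and Q: "{p, q, r, s, t} \<subseteq> nonnbh {e, f}"
    and nonadj: "q \<notin> nbh p" "r \<notin> nbh q" "s \<notin> nbh r" "t \<notin> nbh s" "p \<notin> nbh t"
  shows False
proof -
  define Q where "Q = nonnbh {e, f}"
  define m where "m u = (\<Sum>z\<in>Q. of_bool (z \<notin> nbh u) :: int)" for u
  have [simp]: "finite Q" by (simp add: Q_def)
  have QV: "Q \<subseteq> V" by (auto simp: Q_def nonnbh_def)
  have m: "m u = int (card (Q - nbh u))" for u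
    unfolding m_def of_bool_def by (simp add: sum.If_cases set_diff_eq Int_def)
  \<comment> \<open>Otherwise \<open>z\<close>, \<open>u\<close>, \<open>v\<close>,
    \<open>e\<close>, \<open>f\<close> form a coclique of size five.\<close>
  have mono: "z \<in> nbh u \<or> z \<in> nbh v" if "z \<in> Q" "u \<in> Q" "v \<in> Q" "v \<notin> nbh u" for u v z
  proof (rule ccontr)
    assume *: "\<not> (z \<in> nbh u \<or> z \<in> nbh v)"
    have "coclique {u, e, f}" using that ef by - (rule coclique_insert_nonnbh, auto simp: Q_def)
    then have "coclique {v, u, e, f}" using that by - (rule coclique_insert_nonnbh, auto simp: Q_def nonnbh_insert)
    then have "coclique {z, v, u, e, f}" using that * by - (rule coclique_insert_nonnbh, auto simp: Q_def nonnbh_insert)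
    moreover have "card {z, v, u, e, f} = 5"
    proof -
      have "u \<notin> {e, f}" "v \<notin> {u, e, f}" "z \<notin> {v, u, e, f}"
        using that * by (auto simp: Q_def nonnbh_iff)
      then show ?thesis using ef by simp
    qed
    ultimately show False using coclique_card_le_4 by fastforce
  qed
  have two: "m u + m v \<ge> int (card Q) - 5" if "u \<in> Q" "v \<in> Q" "v \<notin> nbh u" for u v
  proof -
    have "card Q \<le> card ((Q - nbh u) \<union> (Q - nbh v) \<union> (nbh u \<inter> nbh v))"
      by (intro card_mono) auto
    also have "\<dots> \<le> card (Q - nbh u) + card (Q - nbh v) + card (nbh u \<inter> nbh v)"
      by (intro order.trans[OF card_Un_le] add_right_mono card_Un_le)
    finally have "card Q \<le> card (Q - nbh u) + card (Q - nbh v) + card (nbh u \<inter> nbh v)" .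
    moreover have "card (nbh u \<inter> nbh v) \<le> 5" using that QV by (intro card_common_nbh) auto
    ultimately show ?thesis by (simp add: m)
  qed
  have "m p + m q + m r + m s + m t
      = (\<Sum>z\<in>Q. of_bool (z \<notin> nbh p) + of_bool (z \<notin> nbh q) + of_bool (z \<notin> nbh r) + of_bool (z \<notin> nbh s) + of_bool (z \<notin> nbh t))"
    by (simp add: m_def sum.distrib)
  also have "\<dots> \<le> (\<Sum>z\<in>Q. 2)"
  proof (intro sum_mono)
    fix z assume z: "z \<in> Q"
    \<comment> \<open>By \<open>mono\<close>, no two consecutive positions of the pentagon are both
      missed by \<open>z\<close>, which leaves at most two of the five.\<close>
    show "of_bool (z \<notin> nbh p) + of_bool (z \<notin> nbh q) + of_bool (z \<notin> nbh r) + of_bool (z \<notin> nbh s) + of_bool (z \<notin> nbh t) \<le> (2 :: int)"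
      using mono[OF z, of p q] mono[OF z, of q r] mono[OF z, of r s] mono[OF z, of s t] mono[OF z, of t p] Q nonadj
      by (auto simp: Q_def of_bool_def)
  qed
  finally have "m p + m q + m r + m s + m t \<le> 2 * int (card Q)" by simp
  moreover have "card Q \<ge> 28"
    using card_nonnbh_pair[of e f] ef by (auto simp: Q_def coclique_iff)
  \<comment> \<open>Adding \<open>two\<close> around the pentagon gives 5 (|Q| - 5) \<le> 2 * 2 |Q|,
    hence |Q| \<le> 25, against |Q| \<ge> 28.\<close>
  ultimately show False
    using two[of p q] two[of q r] two[of r s] two[of s t] two[of t p] Q nonadj by (auto simp: Q_def)
qed

text \<open>Every clique containing the vertices private to \<open>y\<close> lies in this set. Once
  the set is known to be a clique, it is therefore the unique maximal one, obtained without a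
  choice.\<close>

definition line :: "'a set \<Rightarrow> 'a \<Rightarrow> 'a set" where
  "line Y y = {z \<in> V. nonnbh (Y - {y}) \<subseteq> nbh z}"

lemma finite_line [simp]: "finite (line Y y)"
  by (simp add: line_def finite_V)

lemma clique_card_le: "clique K \<Longrightarrow> card K \<le> 20"
  using clique_le_20[of K] by (auto simp: clique_def)

lemma nonnbh_coclique_4:
  assumes "coclique Y" "card Y = 4"
  shows "nonnbh Y = {}"
proof (rule ccontr)
  assume "nonnbh Y \<noteq> {}"
  then obtain z where z: "z \<in> nonnbh Y" by blast
  then have "z \<notin> Y" by (auto simp: nonnbh_iff)
  then show False
    using coclique_card_le_4[OF coclique_insert_nonnbh[OF assms(1) z]] coclique_finite[OF assms(1)] assms(2) by simp
qed

text \<open>At least 26 - 3 * 5 = 11 vertices are private to \<open>y\<close>. Two nonadjacent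
  vertices of the line would have all of them in common, against the bound 5. A vertex off the line
  misses some private vertex \<open>k\<close>, and its neighbours on the line are common neighbours
  with \<open>k\<close>.\<close>

lemma
  assumes Y: "coclique Y" "card Y = 4" and y: "y \<in> Y"
  shows private_subset_line: "nonnbh (Y - {y}) \<subseteq> line Y y"
    and clique_line: "clique (line Y y)"
    and in_line: "y \<in> line Y y"
    and card_N_Int_line: "\<lbrakk>z \<in> V; z \<notin> line Y y\<rbrakk> \<Longrightarrow> card (N z \<inter> line Y y) \<le> 5"
proof -
  note [simp] = coclique_finite[OF Y(1)]
  let ?K = "nonnbh (Y - {y})"
  have YV: "Y \<subseteq> V" using Y by (simp add: coclique_iff)
  have K: "card ?K \<ge> 11"
  proof -
    have "card (\<Union>v\<in>Y - {y}. nbh y \<inter> nbh v) \<le> (\<Sum>v\<in>Y - {y}. card (nbh y \<inter> nbh v))"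
      by (intro card_UN_le) simp
    also have "\<dots> \<le> (\<Sum>v\<in>Y - {y}. 5)"
      using Y y by (intro sum_mono) (auto simp: coclique_iff subset_iff intro: card_common_nbh)
    also have "\<dots> = 15" using Y y by simp
    finally have "card (\<Union>v\<in>Y - {y}. nbh y \<inter> nbh v) \<le> 15" .
    then have "11 \<le> card (nbh y) - card (\<Union>v\<in>Y - {y}. nbh y \<inter> nbh v)" using card_nbh y YV by auto
    also have "\<dots> \<le> card (nbh y - (\<Union>v\<in>Y - {y}. nbh y \<inter> nbh v))"
      by (intro diff_card_le_card_Diff) simp
    also have "\<dots> \<le> card ?K"
      using nbh_subset[of y] y YV by (intro card_mono) (auto simp: nonnbh_iff subset_iff)
    finally show ?thesis .
  qed
  \<comment> \<open>Two nonadjacent private vertices could replace \<open>y\<close> and give a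
    coclique of size five.\<close>
  have Kc: "w' \<in> nbh w" if w: "w \<in> ?K" "w' \<in> ?K" for w w'
  proof (rule ccontr)
    assume nb: "w' \<notin> nbh w"
    have "coclique (insert w (Y - {y}))"
      using w Y coclique_subset[of Y "Y - {y}"] by - (rule coclique_insert_nonnbh, auto)
    then have "coclique (insert w' (insert w (Y - {y})))"
      using w nb by - (rule coclique_insert_nonnbh, auto simp: nonnbh_insert)
    moreover have "w \<notin> Y - {y}" "w' \<notin> insert w (Y - {y})"
      using w nb nbh_refl[of w] nbh_refl[of w'] unfolding nonnbh_iff by blast+
    then have "card (insert w' (insert w (Y - {y}))) = 5" using Y y by simp
    ultimately show False using coclique_card_le_4 by fastforce
  qed
  show KL: "?K \<subseteq> line Y y" using Kc by (auto simp: line_def nonnbh_iff)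
  have Lc: "z' \<in> nbh z" if z: "z \<in> line Y y" "z' \<in> line Y y" for z z'
  proof (rule ccontr)
    assume "z' \<notin> nbh z"
    then have "card (nbh z \<inter> nbh z') \<le> 5" using z by (intro card_common_nbh) (auto simp: line_def)
    moreover have "card ?K \<le> card (nbh z \<inter> nbh z')" using z by (intro card_mono) (auto simp: line_def)
    ultimately show False using K by simp
  qed
  then show cL: "clique (line Y y)" by (auto simp: clique_iff line_def)
  have "y \<in> ?K" using y YV Y by (auto simp: nonnbh_iff coclique_iff)
  then show "y \<in> line Y y" using KL by blast
  show "card (N z \<inter> line Y y) \<le> 5" if z: "z \<in> V" "z \<notin> line Y y"
  proof -
    obtain k where k: "k \<in> ?K" "k \<notin> nbh z" using z by (auto simp: line_def)
    have "N z \<inter> line Y y \<subseteq> nbh z \<inter> nbh k" using k KL Lc by (auto simp: nbh_def)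
    then have "card (N z \<inter> line Y y) \<le> card (nbh z \<inter> nbh k)" by (intro card_mono) auto
    also have "\<dots> \<le> 5" using z k by (intro card_common_nbh) (auto simp: nonnbh_iff)
    finally show ?thesis .
  qed
qed

text \<open>A vertex hit once is private. If \<open>d\<close> is hit by \<open>a\<close> and
  \<open>b\<close> only and lies on neither line, it misses some \<open>p\<close> private to
  \<open>a\<close> and some \<open>q\<close> private to \<open>b\<close>, and \<open>d\<close>,
  \<open>p\<close>, \<open>b\<close>, \<open>a\<close>, \<open>q\<close> is a forbidden
  pentagon.\<close>

lemma line_cover:
  assumes Y: "coclique Y" "card Y = 4" and d: "d \<in> V" "hits Y d \<le> 2"
  shows "d \<in> (\<Union>y\<in>Y. line Y y)"
proof -
  note [simp] = coclique_finite[OF Y(1)]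
  have "hits Y d \<noteq> 0" using nonnbh_coclique_4[OF Y] d by (auto simp: hits_eq_0_iff nonnbh_def)
  then consider "hits Y d = 1" | "hits Y d = 2" using d by linarith
  then show ?thesis
  proof cases
    case 1
    then obtain y where "{y \<in> Y. d \<in> nbh y} = {y}" by (auto simp: hits_def card_1_singleton_iff)
    then have "d \<in> nonnbh (Y - {y})" "y \<in> Y" using d by (auto simp: nonnbh_iff)
    then show ?thesis using private_subset_line[OF Y] by blast
  next
    case 2
    then obtain a b where ab: "{y \<in> Y. d \<in> nbh y} = {a, b}" "a \<noteq> b" by (auto simp: hits_def card_2_iff)
    then have abY: "a \<in> Y" "b \<in> Y" "d \<in> nbh a" "d \<in> nbh b" by auto
    then have "card (Y - {a, b}) = 2" using Y ab by (simp add: card_Diff_subset)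
    then obtain e f where ef: "Y - {a, b} = {e, f}" "e \<noteq> f" by (auto simp: card_2_iff)
    have efY: "coclique {e, f}" using Y coclique_subset[of Y "{e, f}"] ef by auto
    show ?thesis
    proof (rule ccontr)
      assume "d \<notin> (\<Union>y\<in>Y. line Y y)"
      then obtain p q where p: "p \<in> nonnbh (Y - {a})" "p \<notin> nbh d" and q: "q \<in> nonnbh (Y - {b})" "q \<notin> nbh d"
        using abY(1,2) d(1) unfolding line_def by blast
      have Ysub: "b \<in> Y - {a}" "a \<in> Y - {b}" "{e, f} \<subseteq> Y - {a}" "{e, f} \<subseteq> Y - {b}" "{e, f} \<subseteq> Y"
        using ab abY ef by auto
      have YB: "v \<notin> nbh u" if "u \<in> Y" "v \<in> Y" "u \<noteq> v" for u v
        using Y that by (auto simp: coclique_iff)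
      have "d \<notin> nbh e" "d \<notin> nbh f"
        using ab(1) ef(1) by blast+
      then have "{d, p, b, a, q} \<subseteq> nonnbh {e, f}"
        using p q d Ysub abY YB Y ef by (auto simp: nonnbh_iff coclique_iff)
      moreover have "p \<notin> nbh d" "b \<notin> nbh p" "a \<notin> nbh b" "q \<notin> nbh a" "d \<notin> nbh q"
        using p q Ysub YB[OF abY(2,1)] ab(2) nbh_commute by (auto simp: nonnbh_iff)
      ultimately show False using no_pentagon[OF efY ef(2)] by blast
    qed
  qed
qed

section \<open>Counting the vertices covered by the four lines\<close>

lemma card_uncovered:
  assumes Y: "coclique Y" "card Y = 4"
  shows "card (V - (\<Union>y\<in>Y. line Y y)) \<le> 6"
proof -
  let ?U = "V - (\<Union>y\<in>Y. line Y y)"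
  have [simp]: "finite V" by (rule finite_V)
  have "2 * int (card ?U) = (\<Sum>z\<in>V. if z \<in> ?U then 2 else 0)"
    by (simp add: sum.If_cases Int_absorb1 Diff_subset Int_def set_diff_eq)
  also have "\<dots> \<le> (\<Sum>z\<in>V. (int (hits Y z) - 1) * (int (hits Y z) - 2))"
  proof (intro sum_mono)
    fix z assume z: "z \<in> V"
    \<comment> \<open>An uncovered vertex is hit at least three times and so contributes at least 2,
      while the whole sum is at most 160 - 208 + 60 = 12.\<close>
    have "2 * 1 \<le> (int (hits Y z) - 1) * (int (hits Y z) - 2)" if "z \<in> ?U"
    proof -
      have "hits Y z \<ge> 3" using line_cover[OF Y z] that by force
      then show ?thesis by (intro mult_mono) auto
    qed
    then show "(if z \<in> ?U then 2 else 0) \<le> (int (hits Y z) - 1) * (int (hits Y z) - 2)"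
      using quadratic_nonneg by auto
  qed
  also have "\<dots> \<le> 12" using sum_hits_quadratic[OF Y(1)] pairs_sum_le[OF Y(1)] Y(2) by simp
  finally show ?thesis by simp
qed

lemma sum_card_line:
  assumes Y: "coclique Y" "card Y = 4"
  shows "(\<Sum>y\<in>Y. card (line Y y)) \<ge> 74"
proof -
  have "80 = card ((V - (\<Union>y\<in>Y. line Y y)) \<union> (\<Union>y\<in>Y. line Y y))"
    unfolding card_V[symmetric] by (intro arg_cong[where f=card]) (auto simp: line_def)
  also have "\<dots> \<le> card (V - (\<Union>y\<in>Y. line Y y)) + card (\<Union>y\<in>Y. line Y y)" by (rule card_Un_le)
  also have "card (\<Union>y\<in>Y. line Y y) \<le> (\<Sum>y\<in>Y. card (line Y y))"
    using coclique_finite[OF Y(1)] by (rule card_UN_le)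
  finally show ?thesis using card_uncovered[OF Y] by linarith
qed

lemma card_line_ge:
  assumes Y: "coclique Y" "card Y = 4" and y: "y \<in> Y"
  shows "card (line Y y) \<ge> 14"
proof -
  note [simp] = coclique_finite[OF Y(1)]
  have "(\<Sum>v\<in>Y. card (line Y v)) = card (line Y y) + (\<Sum>v\<in>Y - {y}. card (line Y v))"
    using y by (simp add: sum.remove)
  also have "(\<Sum>v\<in>Y - {y}. card (line Y v)) \<le> (\<Sum>v\<in>Y - {y}. 20)"
    using clique_card_le clique_line[OF Y] by (intro sum_mono) auto
  also have "\<dots> = 60" using Y y by simp
  finally show ?thesis using sum_card_line[OF Y] by linarith
qed

text \<open>Greedy extension: three closed neighbourhoods cover at most 78 of the 80
  vertices.\<close>

lemma ex_coclique_4: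
  assumes "v \<in> V"
  shows "\<exists>Y. v \<in> Y \<and> coclique Y \<and> card Y = 4"
proof -
  have ext: "\<exists>z. z \<notin> Y \<and> coclique (insert z Y)" if Y: "coclique Y" "card Y \<le> 3" for Y
  proof -
    note [simp] = coclique_finite[OF Y(1)]
    have "card (\<Union>y\<in>Y. nbh y) \<le> (\<Sum>y\<in>Y. card (nbh y))" by (intro card_UN_le) simp
    also have "\<dots> = (\<Sum>y\<in>Y. 26)" using Y by (intro sum.cong) (auto simp: card_nbh coclique_iff)
    finally have "card (\<Union>y\<in>Y. nbh y) \<le> 78" using Y(2) by simp
    then have "\<not> V \<subseteq> (\<Union>y\<in>Y. nbh y)" using card_mono[of "\<Union>y\<in>Y. nbh y" V] card_V by auto
    then obtain z where "z \<in> nonnbh Y" by (auto simp: nonnbh_iff)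
    moreover from this have "z \<notin> Y" by (auto simp: nonnbh_iff)
    ultimately show ?thesis using coclique_insert_nonnbh[OF Y(1)] by blast
  qed
  have "\<exists>Y. v \<in> Y \<and> coclique Y \<and> card Y = Suc n" if "n \<le> 3" for n
    using that
  proof (induction n)
    case 0
    then show ?case using assms by (intro exI[of _ "{v}"]) (auto simp: coclique_def)
  next
    case (Suc n)
    then obtain Y where Y: "v \<in> Y" "coclique Y" "card Y = Suc n" by auto
    then obtain z where "z \<notin> Y" "coclique (insert z Y)" using ext[of Y] Suc.prems by auto
    then show ?case using Y coclique_finite[OF Y(2)] by (intro exI[of _ "insert z Y"]) auto
  qed
  from this[of 3] show ?thesis by simp
qed

text \<open>
  An uncovered vertex \<open>u\<close> lies in a clique \<open>C\<close> of size at least \<open>14\<close>, which has to meet two lines.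
  Those two have at most \<open>17\<close> vertices, so the other two are tight, and \<open>u\<close> has too few neighbours.
\<close>

lemma all_covered:
  assumes Y: "coclique Y" "card Y = 4"
  shows "V = (\<Union>y\<in>Y. line Y y)"
proof (rule ccontr)
  note [simp] = coclique_finite[OF Y(1)] finite_V
  define U where "U = V - (\<Union>y\<in>Y. line Y y)"
  have cU: "card U \<le> 6" using card_uncovered[OF Y] by (simp add: U_def)
  have [simp]: "finite U" by (simp add: U_def)
  assume "V \<noteq> (\<Union>y\<in>Y. line Y y)"
  then obtain u where u: "u \<in> U" by (auto simp: U_def line_def)
  then have uV: "u \<in> V" and uL: "y \<in> Y \<Longrightarrow> u \<notin> line Y y" for y by (auto simp: U_def)
  obtain Y' where Y': "u \<in> Y'" "coclique Y'" "card Y' = 4" using ex_coclique_4[OF uV] by blast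
  define C where "C = line Y' u"
  have C: "clique C" "u \<in> C" "card C \<ge> 14" and [simp]: "finite C"
    using clique_line[OF Y'(2,3,1)] in_line[OF Y'(2,3,1)] card_line_ge[OF Y'(2,3,1)] by (auto simp: C_def)
  have CL: "card (C \<inter> line Y y) \<le> 5" if "y \<in> Y" for y
  proof -
    have "card (C \<inter> line Y y) \<le> card (N u \<inter> line Y y)"
      using C uL[OF that] by (intro card_mono) (auto simp: clique_def)
    also have "\<dots> \<le> 5" using card_N_Int_line[OF Y that uV uL[OF that]] .
    finally show ?thesis .
  qed
  \<comment> \<open>If \<open>w\<close> lies on both cliques, their union is inside
    \<open>nbh w\<close>, so the line has at most 26 + 5 - 14 = 17 vertices.\<close>
  have small: "card (line Y y) \<le> 17" if y: "y \<in> Y" "C \<inter> line Y y \<noteq> {}" for y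
  proof -
    obtain w where w: "w \<in> C" "w \<in> line Y y" using y by blast
    have "line Y y \<union> C \<subseteq> nbh w" using w C clique_line[OF Y y(1)] by (auto simp: clique_iff)
    then have "card (line Y y \<union> C) \<le> 26" using card_mono[of "nbh w"] card_nbh[of w] w by (auto simp: line_def)
    moreover have "card (line Y y) + card C = card (line Y y \<union> C) + card (C \<inter> line Y y)"
      by (subst card_Un_Int) (auto simp: Int_commute)
    ultimately show ?thesis using CL[OF y(1)] C by linarith
  qed
  have CVsub: "C \<subseteq> U \<union> (\<Union>y\<in>Y. C \<inter> line Y y)" using C by (auto simp: U_def clique_def)
  \<comment> \<open>Of the at least 14 vertices of \<open>C\<close> at most six are uncovered. The
    remaining eight do not fit on one line, which meets \<open>C\<close> in at most five
    vertices.\<close>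
  have cS: "8 \<le> (\<Sum>y\<in>Y. card (C \<inter> line Y y))"
  proof -
    have "card C \<le> card (U \<union> (\<Union>y\<in>Y. C \<inter> line Y y))" using CVsub by (intro card_mono) auto
    also have "\<dots> \<le> card U + card (\<Union>y\<in>Y. C \<inter> line Y y)" by (rule card_Un_le)
    also have "card (\<Union>y\<in>Y. C \<inter> line Y y) \<le> (\<Sum>y\<in>Y. card (C \<inter> line Y y))" by (intro card_UN_le) simp
    finally show ?thesis using C cU by linarith
  qed
  obtain a where a: "a \<in> Y" "C \<inter> line Y a \<noteq> {}"
  proof -
    have "\<exists>a\<in>Y. C \<inter> line Y a \<noteq> {}"
    proof (rule ccontr)
      assume "\<not> ?thesis"
      then have "(\<Sum>y\<in>Y. card (C \<inter> line Y y)) = 0" by simp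
      with cS show False by simp
    qed
    then show ?thesis using that by blast
  qed
  obtain b where b: "b \<in> Y - {a}" "C \<inter> line Y b \<noteq> {}"
  proof -
    have "\<exists>b\<in>Y - {a}. C \<inter> line Y b \<noteq> {}"
    proof (rule ccontr)
      assume "\<not> ?thesis"
      then have "(\<Sum>y\<in>Y - {a}. card (C \<inter> line Y y)) = 0" by simp
      moreover have "(\<Sum>y\<in>Y. card (C \<inter> line Y y)) = card (C \<inter> line Y a) + (\<Sum>y\<in>Y - {a}. card (C \<inter> line Y y))"
        using a by (simp add: sum.remove)
      ultimately show False using cS CL[OF a(1)] by linarith
    qed
    then show ?thesis using that by blast
  qed
  have "card (Y - {a, b}) = 2" using a(1) b(1) Y by (auto simp: card_Diff_subset)
  then obtain c e where ce: "Y - {a, b} = {c, e}" "c \<noteq> e" by (auto simp: card_2_iff)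
  have Yeq: "Y = {a, b, c, e}" "distinct [a, b, c, e]" using ce a b by auto
  have sumY: "(\<Sum>y\<in>Y. g y) = g a + g b + g c + g e" for g :: "'a \<Rightarrow> nat"
    using Yeq(2) by (subst Yeq(1)) (simp add: add.assoc)
  have "card (line Y a) \<le> 17" "card (line Y b) \<le> 17" using small a b by auto
  moreover have le: "card (line Y c) \<le> 20" "card (line Y e) \<le> 20"
    using clique_card_le[OF clique_line[OF Y]] Yeq by auto
  \<comment> \<open>The total of at least 74 minus 17 + 17 + 20 forces size 20.\<close>
  ultimately have c20: "card (line Y c) = 20" "card (line Y e) = 20"
    using sum_card_line[OF Y] unfolding sumY by linarith+
  have "card (N u \<inter> line Y y) = 2" if "y \<in> {c, e}" for y
    using clique_20_tight[of "line Y y" u] clique_line[OF Y, of y] that c20 uV uL Yeq(1)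
    by (auto simp: clique_def)
  then have "card (N u \<inter> line Y c) = 2" "card (N u \<inter> line Y e) = 2" by auto
  moreover have "card (N u \<inter> line Y a) \<le> 5" "card (N u \<inter> line Y b) \<le> 5"
    using card_N_Int_line[OF Y _ uV uL] a b by auto
  ultimately have s: "(\<Sum>y\<in>Y. card (N u \<inter> line Y y)) \<le> 14" unfolding sumY by linarith
  have "card (N u) \<le> card ((U - {u}) \<union> (\<Union>y\<in>Y. N u \<inter> line Y y))"
    using N_subset[of u] N_irrefl by (intro card_mono) (auto simp: U_def)
  also have "\<dots> \<le> card (U - {u}) + card (\<Union>y\<in>Y. N u \<inter> line Y y)" by (rule card_Un_le)
  also have "card (\<Union>y\<in>Y. N u \<inter> line Y y) \<le> (\<Sum>y\<in>Y. card (N u \<inter> line Y y))" by (intro card_UN_le) simp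
  finally have "card (N u) \<le> card (U - {u}) + 14" using s by linarith
  moreover have "card (U - {u}) \<le> 5" using cU u by simp
  \<comment> \<open>The degree of \<open>u\<close> would be at most 5 + (5 + 5 + 2 + 2) =
    19.\<close>
  ultimately show False using card_N[OF uV] by simp
qed

lemma four_cliques:
  "\<exists>C. card C = 4 \<and> pairwise disjnt C \<and> (\<forall>K\<in>C. clique K \<and> card K = 20)"
proof -
  have "V \<noteq> {}" using card_V by auto
  then obtain Y where Y: "coclique Y" "card Y = 4" using ex_coclique_4 by blast
  note [simp] = coclique_finite[OF Y(1)]
  have le: "card (line Y y) \<le> 20" if "y \<in> Y" for y
    using clique_card_le[OF clique_line[OF Y that]] .
  have two: "card (line Y a \<union> line Y b) \<ge> 40" if ab: "a \<in> Y" "b \<in> Y" "a \<noteq> b" for a b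
  proof -
    have "80 = card (line Y a \<union> line Y b \<union> (\<Union>y\<in>Y - {a, b}. line Y y))"
      unfolding card_V[symmetric] by (subst all_covered[OF Y], rule arg_cong[where f=card]) (use ab in auto)
    also have "\<dots> \<le> card (line Y a \<union> line Y b) + card (\<Union>y\<in>Y - {a, b}. line Y y)" by (rule card_Un_le)
    also have "card (\<Union>y\<in>Y - {a, b}. line Y y) \<le> (\<Sum>y\<in>Y - {a, b}. card (line Y y))" by (intro card_UN_le) simp
    also have "\<dots> \<le> (\<Sum>y\<in>Y - {a, b}. 20)" using le by (intro sum_mono) auto
    also have "\<dots> = 40" using ab Y by (simp add: card_Diff_subset)
    finally show ?thesis by simp
  qed
  have disj: "card (line Y a) = 20" "line Y a \<inter> line Y b = {}" if ab: "a \<in> Y" "b \<in> Y" "a \<noteq> b" for a b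
  proof -
    have "card (line Y a) + card (line Y b) = card (line Y a \<union> line Y b) + card (line Y a \<inter> line Y b)"
      by (rule card_Un_Int) auto
    then have "card (line Y a \<inter> line Y b) = 0" "card (line Y a) = 20"
      using two[OF ab] le[OF ab(1)] le[OF ab(2)] by linarith+
    then show "card (line Y a) = 20" "line Y a \<inter> line Y b = {}" by auto
  qed
  have ne: "\<exists>b\<in>Y. a \<noteq> b" if "a \<in> Y" for a
  proof -
    have "Y \<noteq> {a}" using Y(2) by auto
    then show ?thesis using that by auto
  qed
  \<comment> \<open>Lines of different members are disjoint and nonempty, so the image really
    consists of four sets.\<close>
  have "inj_on (line Y) Y"
  proof (rule inj_onI, rule ccontr)
    fix a b assume ab: "a \<in> Y" "b \<in> Y" "line Y a = line Y b" "a \<noteq> b"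
    then show False using disj(2)[of a b] in_line[OF Y, of a] by auto
  qed
  then have "card (line Y ` Y) = 4" using Y(2) by (simp add: card_image)
  moreover have "pairwise disjnt (line Y ` Y)"
    using disj(2) by (auto simp: pairwise_def disjnt_def)
  moreover have "clique (line Y y) \<and> card (line Y y) = 20" if "y \<in> Y" for y
    using clique_line[OF Y that] disj(1)[OF that] ne[OF that] by auto
  ultimately show ?thesis by (intro exI[of _ "line Y ` Y"]) auto
qed

end

section \<open>The Delsarte bound\<close>

lemma less_4_cases: "(n::nat) \<le> 3 \<Longrightarrow> n = 0 \<or> n = 1 \<or> n = 2 \<or> n = 3"
  by linarith

text \<open>Distances are natural numbers here; with \<open>Suc\<close> on the left, the count of
  closer neighbours is empty at distance 0 instead of suffering from truncated subtraction.\<close>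

locale drg_80_54_12 =
  fixes V :: "'a set" and N :: "'a \<Rightarrow> 'a set" and \<delta> :: "'a \<Rightarrow> 'a \<Rightarrow> nat"
  assumes finite_V: "finite V"
    and N_iff: "v \<in> N u \<longleftrightarrow> u \<in> V \<and> v \<in> V \<and> \<delta> u v = 1"
    and \<delta>_sym: "\<lbrakk>u \<in> V; v \<in> V\<rbrakk> \<Longrightarrow> \<delta> u v = \<delta> v u"
    and \<delta>_0_iff: "\<lbrakk>u \<in> V; v \<in> V\<rbrakk> \<Longrightarrow> \<delta> u v = 0 \<longleftrightarrow> u = v"
    and \<delta>_le_3: "\<lbrakk>u \<in> V; v \<in> V\<rbrakk> \<Longrightarrow> \<delta> u v \<le> 3"
    and \<delta>_step: "\<lbrakk>u \<in> V; w \<in> N v\<rbrakk> \<Longrightarrow> \<delta> u w \<le> Suc (\<delta> u v)"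
    and card_closer: "\<lbrakk>u \<in> V; v \<in> V\<rbrakk> \<Longrightarrow> card {w \<in> N v. Suc (\<delta> u w) = \<delta> u v} = [0, 1, 6, 60] ! \<delta> u v"
    and card_farther: "\<lbrakk>u \<in> V; v \<in> V\<rbrakk> \<Longrightarrow> card {w \<in> N v. \<delta> u w = Suc (\<delta> u v)} = [80, 54, 12, 0] ! \<delta> u v"
begin

lemma N_subset: "N v \<subseteq> V"
  by (auto simp: N_iff)

lemma finite_N [simp]: "finite (N v)"
  using N_subset finite_V finite_subset by blast

lemma N_sym: "u \<in> N v \<longleftrightarrow> v \<in> N u"
  using \<delta>_sym by (auto simp: N_iff)

lemma \<delta>_refl: "v \<in> V \<Longrightarrow> \<delta> v v = 0"
  by (simp add: \<delta>_0_iff)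

lemma N_irrefl: "v \<notin> N v"
  using \<delta>_refl by (auto simp: N_iff)

lemma card_N:
  assumes "v \<in> V"
  shows "card (N v) = 80"
proof -
  have "{w \<in> N v. \<delta> v w = Suc (\<delta> v v)} = N v"
    using assms by (auto simp: N_iff \<delta>_refl)
  then show ?thesis using card_farther[OF assms assms] assms by (simp add: \<delta>_refl)
qed

lemma \<delta>_N_cases:
  assumes "u \<in> V" "v \<in> V" "w \<in> N v"
  shows "Suc (\<delta> u w) = \<delta> u v \<or> \<delta> u w = \<delta> u v \<or> \<delta> u w = Suc (\<delta> u v)"
proof -
  have "\<delta> u v \<le> Suc (\<delta> u w)" using \<delta>_step[of u v w] assms N_sym by blast
  moreover have "\<delta> u w \<le> Suc (\<delta> u v)" using \<delta>_step assms by blast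
  ultimately show ?thesis by linarith
qed

text \<open>The middle coefficients are 80 - b_i - c_i. The out-of-range arguments, the truncated
  \<open>0 - 1\<close> and the index 4, occur only with coefficient 0.\<close>

lemma sum_N_by_distance:
  fixes a :: "nat \<Rightarrow> real"
  assumes "u \<in> V" "v \<in> V"
  shows "(\<Sum>w\<in>N v. a (\<delta> u w))
    = [0, 1, 6, 60] ! \<delta> u v * a (\<delta> u v - 1) + [0, 25, 62, 20] ! \<delta> u v * a (\<delta> u v)
      + [80, 54, 12, 0] ! \<delta> u v * a (Suc (\<delta> u v))"
proof -
  let ?A = "{w \<in> N v. Suc (\<delta> u w) = \<delta> u v}" and ?B = "{w \<in> N v. \<delta> u w = \<delta> u v}"
    and ?C = "{w \<in> N v. \<delta> u w = Suc (\<delta> u v)}"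
  have split: "(\<Sum>w\<in>N v. h (\<delta> u w))
      = real (card ?A) * h (\<delta> u v - 1) + real (card ?B) * h (\<delta> u v) + real (card ?C) * h (Suc (\<delta> u v))"
    for h :: "nat \<Rightarrow> real"
  proof -
    have "N v = ?A \<union> ?B \<union> ?C" using \<delta>_N_cases[OF assms] by blast
    then have "(\<Sum>w\<in>N v. h (\<delta> u w)) = (\<Sum>w\<in>?A \<union> ?B \<union> ?C. h (\<delta> u w))" by simp
    also have "\<dots> = (\<Sum>w\<in>?A. h (\<delta> u w)) + (\<Sum>w\<in>?B. h (\<delta> u w)) + (\<Sum>w\<in>?C. h (\<delta> u w))"
      by (subst sum.union_disjoint; (subst sum.union_disjoint)?) auto
    also have "(\<Sum>w\<in>?A. h (\<delta> u w)) = (\<Sum>w\<in>?A. h (\<delta> u v - 1))"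
    proof (intro sum.cong refl)
      fix w assume "w \<in> ?A"
      then have "\<delta> u v - 1 = \<delta> u w" by auto
      then show "h (\<delta> u w) = h (\<delta> u v - 1)" by simp
    qed
    finally show ?thesis by simp
  qed
  have "80 = real (card ?A) + real (card ?B) + real (card ?C)"
    using split[of "\<lambda>_. 1"] card_N assms by simp
  then have "real (card ?B) = [0, 25, 62, 20] ! \<delta> u v"
    using card_closer[OF assms] card_farther[OF assms] less_4_cases[OF \<delta>_le_3[OF assms]] by auto
  moreover have "real (card ?A) = [0, 1, 6, 60] ! \<delta> u v" "real (card ?C) = [80, 54, 12, 0] ! \<delta> u v"
    using card_closer[OF assms] card_farther[OF assms] less_4_cases[OF \<delta>_le_3[OF assms]] by auto
  ultimately show ?thesis using split[of a] by simp
qed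

lemma card_common_N:
  assumes "u \<in> V" "v \<in> V"
  shows "card (N u \<inter> N v) = [80, 25, 6, 0] ! \<delta> u v"
proof -
  have "N u \<inter> N v = {w \<in> N v. \<delta> u w = 1}"
    using assms by (auto simp: N_iff)
  then have "real (card (N u \<inter> N v)) = (\<Sum>w\<in>N v. if \<delta> u w = 1 then 1 else 0)"
    by (simp add: sum.If_cases Int_def)
  also have "\<dots> = real ([80, 25, 6, 0] ! \<delta> u v)"
    using less_4_cases[OF \<delta>_le_3[OF assms]]
    by (subst sum_N_by_distance[OF assms, of "\<lambda>i. if i = 1 then 1 else 0"]) auto
  finally show ?thesis by simp
qed

text \<open>The standard sequence of the eigenvalue \<open>-4\<close>.\<close>

definition cosine :: "nat \<Rightarrow> real" where
  "cosine i = [1, -1/20, 1/120, -1/48] ! i"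

lemma sum_cosine_N:
  assumes "u \<in> V" "v \<in> V"
  shows "(\<Sum>w\<in>N v. cosine (\<delta> u w)) = -4 * cosine (\<delta> u v)"
  using sum_N_by_distance[OF assms, of cosine] less_4_cases[OF \<delta>_le_3[OF assms]]
  by (auto simp: cosine_def)

section \<open>The cosine matrix and the clique bound\<close>

lemma sum_N_swap:
  fixes h :: "'a \<Rightarrow> real"
  assumes "finite A" "A \<subseteq> V"
  shows "(\<Sum>v\<in>A. \<Sum>w\<in>N v. h w) = (\<Sum>w\<in>V. real (card (N w \<inter> A)) * h w)"
proof -
  have "(\<Sum>v\<in>A. \<Sum>w\<in>N v. h w) = (\<Sum>v\<in>A. \<Sum>w\<in>V. if w \<in> N v then h w else 0)"
    using N_subset finite_V by (intro sum.cong[OF refl]) (simp add: sum.If_cases Int_absorb1)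
  also have "\<dots> = (\<Sum>w\<in>V. \<Sum>v\<in>A. if v \<in> N w then h w else 0)"
    by (subst sum.swap) (simp add: N_sym)
  also have "\<dots> = (\<Sum>w\<in>V. real (card (N w \<inter> A)) * h w)"
    using assms by (intro sum.cong[OF refl]) (simp add: sum.If_cases Int_commute)
  finally show ?thesis .
qed

text \<open>The matrix of cosines is a multiple of the projection onto the eigenspace of -4. The
  sums \<open>s i\<close> over the spheres around \<open>v\<close> are multiples of
  \<open>g v\<close>: \<open>s 2\<close> comes from applying the adjacency operator twice, and
  \<open>s 3\<close> from the total sum being 0.\<close>

lemma eigenvector_sum_cosine:
  assumes eig: "\<And>v. v \<in> V \<Longrightarrow> (\<Sum>w\<in>N v. g w) = -4 * g v" and v: "v \<in> V"
  shows "(\<Sum>w\<in>V. cosine (\<delta> v w) * g w) = 21 / 16 * g v"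
proof -
  note [simp] = finite_V
  define s where "s i = (\<Sum>w | w \<in> V \<and> \<delta> v w = i. g w)" for i
  have split: "(\<Sum>w\<in>V. a (\<delta> v w) * g w) = a 0 * s 0 + a 1 * s 1 + a 2 * s 2 + a 3 * s 3" for a :: "nat \<Rightarrow> real"
  proof -
    have "(\<Sum>w\<in>V. a (\<delta> v w) * g w) = (\<Sum>i\<le>3. \<Sum>w | w \<in> V \<and> \<delta> v w = i. a (\<delta> v w) * g w)"
      using \<delta>_le_3[OF v] by (intro sum.group[symmetric]) auto
    also have "\<dots> = (\<Sum>i\<le>3. a i * s i)"
      unfolding s_def sum_distrib_left by (intro sum.cong refl) auto
    finally show ?thesis by (simp add: eval_nat_numeral)
  qed
  have "{w \<in> V. \<delta> v w = 0} = {v}" using v \<delta>_0_iff by auto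
  then have s0: "s 0 = g v" by (simp add: s_def)
  have "{w \<in> V. \<delta> v w = 1} = N v" using v by (auto simp: N_iff)
  then have s1: "s 1 = -4 * g v" using eig[OF v] by (simp add: s_def)
  have "(\<Sum>u\<in>N v. \<Sum>w\<in>N u. g w) = (\<Sum>u\<in>N v. -4 * g u)"
    using N_subset by (intro sum.cong refl eig) auto
  also have "\<dots> = -4 * (\<Sum>u\<in>N v. g u)" by (rule sum_distrib_left[symmetric])
  also have "\<dots> = 16 * g v" using eig[OF v] by simp
  finally have "16 * g v = (\<Sum>w\<in>V. real (card (N w \<inter> N v)) * g w)"
    using sum_N_swap[of "N v" g] N_subset by simp
  also have "\<dots> = (\<Sum>w\<in>V. real ([80, 25, 6, 0] ! \<delta> v w) * g w)"
    using card_common_N[OF v] by (intro sum.cong refl) (simp add: Int_commute)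
  also have "\<dots> = 80 * s 0 + 25 * s 1 + 6 * s 2"
    by (subst split) simp
  finally have s2: "s 2 = 6 * g v" using s0 s1 by simp
  have "(\<Sum>u\<in>V. \<Sum>w\<in>N u. g w) = (\<Sum>w\<in>V. 80 * g w)"
    using N_subset card_N by (subst sum_N_swap) (auto intro!: sum.cong simp: Int_absorb2)
  moreover have "(\<Sum>u\<in>V. \<Sum>w\<in>N u. g w) = (\<Sum>u\<in>V. -4 * g u)"
    using eig by (intro sum.cong) auto
  ultimately have "80 * (\<Sum>w\<in>V. g w) = -4 * (\<Sum>w\<in>V. g w)" by (simp only: sum_distrib_left)
  then have "(\<Sum>w\<in>V. g w) = 0" by simp
  then have s3: "s 3 = -3 * g v" using split[of "\<lambda>_. 1"] s0 s1 s2 by simp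
  show ?thesis using s0 s1 s2 s3 by (subst split) (simp add: cosine_def)
qed

text \<open>Let E be the matrix of cosines and 1_C the indicator vector of \<open>C\<close>, so that
  g = E 1_C. As E acts on g by 21/16, the sum of g over \<open>C\<close> is 16/21 times the squared
  norm of g.\<close>

lemma
  assumes "C \<subseteq> V"
  defines "g \<equiv> \<lambda>v. \<Sum>y\<in>C. cosine (\<delta> y v)"
  shows cosine_sum_nonneg: "(\<Sum>y\<in>C. g y) \<ge> 0"
    and cosine_sum_eq_0: "\<lbrakk>(\<Sum>y\<in>C. g y) = 0; v \<in> V\<rbrakk> \<Longrightarrow> g v = 0"
proof -
  note [simp] = finite_V
  have eig: "(\<Sum>w\<in>N v. g w) = -4 * g v" if "v \<in> V" for v
    unfolding g_def using that assms
    by (subst sum.swap) (auto simp: sum_distrib_left sum_cosine_N subset_iff intro!: sum.cong)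
  have "(\<Sum>v\<in>V. g v ^ 2) = (\<Sum>v\<in>V. \<Sum>y\<in>C. cosine (\<delta> y v) * g v)"
    by (simp add: power2_eq_square g_def sum_distrib_right)
  also have "\<dots> = (\<Sum>y\<in>C. \<Sum>v\<in>V. cosine (\<delta> y v) * g v)" by (rule sum.swap)
  also have "\<dots> = (\<Sum>y\<in>C. 21 / 16 * g y)"
    using assms(1) by (intro sum.cong refl eigenvector_sum_cosine eig) auto
  finally have sq: "(\<Sum>v\<in>V. g v ^ 2) = 21 / 16 * (\<Sum>y\<in>C. g y)" by (simp add: sum_distrib_left)
  have "0 \<le> (\<Sum>v\<in>V. g v ^ 2)" by (intro sum_nonneg) auto
  then show "(\<Sum>y\<in>C. g y) \<ge> 0" using sq by simp
  show "g v = 0" if "(\<Sum>y\<in>C. g y) = 0" "v \<in> V"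
    using sq that sum_nonneg_eq_0_iff[of V "\<lambda>v. g v ^ 2"] by auto
qed

text \<open>Within a clique each value of the cosine sum is 1 - (|C| - 1) / 20. Its nonnegativity
  gives 21, and at 21 the sum vanishes at every vertex of the graph.\<close>

lemma
  assumes C: "C \<subseteq> V" "C \<noteq> {}" "\<And>u v. \<lbrakk>u \<in> C; v \<in> C; u \<noteq> v\<rbrakk> \<Longrightarrow> v \<in> N u"
  shows clique_card_le_21: "card C \<le> 21"
    and clique_21_tight: "\<lbrakk>card C = 21; v \<in> V\<rbrakk> \<Longrightarrow> (\<Sum>y\<in>C. cosine (\<delta> y v)) = 0"
proof -
  have fin [simp]: "finite C" using C(1) finite_V finite_subset by blast
  have pos: "card C > 0" using C(2) by (simp add: card_gt_0_iff)
  have "(\<Sum>y\<in>C. cosine (\<delta> y v)) = 1 - (real (card C) - 1) / 20" if v: "v \<in> C" for v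
  proof -
    have "(\<Sum>y\<in>C. cosine (\<delta> y v)) = cosine (\<delta> v v) + (\<Sum>y\<in>C - {v}. cosine (\<delta> y v))"
      using v by (simp add: sum.remove)
    also have "(\<Sum>y\<in>C - {v}. cosine (\<delta> y v)) = (\<Sum>y\<in>C - {v}. - 1 / 20)"
      using C(3)[of _ v] v by (intro sum.cong refl) (auto simp: N_iff cosine_def)
    also have "cosine (\<delta> v v) = 1" using v C(1) by (auto simp: \<delta>_refl cosine_def)
    finally show ?thesis using v pos by (simp add: card_Diff_singleton of_nat_diff)
  qed
  then have s: "(\<Sum>v\<in>C. \<Sum>y\<in>C. cosine (\<delta> y v)) = real (card C) * (1 - (real (card C) - 1) / 20)"
    by simp
  have "real (card C) * (1 - (real (card C) - 1) / 20) \<ge> 0"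
    using cosine_sum_nonneg[OF C(1)] s by simp
  then show "card C \<le> 21" using pos by (auto simp: zero_le_mult_iff)
  show "(\<Sum>y\<in>C. cosine (\<delta> y v)) = 0" if "card C = 21" "v \<in> V"
    using cosine_sum_eq_0[OF C(1) _ that(2)] s that(1) by simp
qed

text \<open>The two clique conditions follow by adding \<open>x\<close> to a clique of the local
  graph and using the bound 21. Adjacency is cut down to \<open>N x\<close> because the locale
  constrains neighbourhoods of all elements of the type.\<close>

lemma local_graph:
  assumes x: "x \<in> V"
  shows "local_graph_80 (N x) (\<lambda>y. if y \<in> N x then N x \<inter> N y else {})"
proof
  note NV = N_subset[THEN subsetD]
  show "finite (N x)" by simp
  show "card (N x) = 80" using card_N[OF x] .
  show "(if v \<in> N x then N x \<inter> N v else {}) \<subseteq> N x" for v by auto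
  show "v \<notin> (if v \<in> N x then N x \<inter> N v else {})" for v using N_irrefl by auto
  show "v \<in> (if u \<in> N x then N x \<inter> N u else {})" if "u \<in> (if v \<in> N x then N x \<inter> N v else {})" for u v
    using that N_sym by (auto split: if_splits)
  show "card (if v \<in> N x then N x \<inter> N v else {}) = 25" if "v \<in> N x" for v
    using that card_common_N[OF x, of v] by (auto simp: N_iff)
  have adj: "v \<in> N u" if "u \<in> N x" "v \<in> (if u \<in> N x then N x \<inter> N u else {})" for u v
    using that by (auto split: if_splits)
  have dist2: "\<delta> u v = 2" if "u \<in> N x" "v \<in> N x" "u \<noteq> v" "v \<notin> N u" for u v
  proof -
    have "\<delta> u v \<le> Suc (\<delta> u x)" using \<delta>_step[of u v x] that NV by auto
    moreover have "\<delta> u x = 1" using that N_sym by (auto simp: N_iff)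
    moreover have "\<delta> u v \<noteq> 0" "\<delta> u v \<noteq> 1" using that \<delta>_0_iff by (auto simp: N_iff)
    ultimately show ?thesis by linarith
  qed
  show "card ((if u \<in> N x then N x \<inter> N u else {}) \<inter> (if v \<in> N x then N x \<inter> N v else {})) \<le> 5"
    if uv: "u \<in> N x" "v \<in> N x" "u \<noteq> v" "v \<notin> (if u \<in> N x then N x \<inter> N u else {})" for u v
  proof -
    have "card (N u \<inter> N v) = 6"
      using card_common_N[of u v] dist2[of u v] uv NV by auto
    \<comment> \<open>One of the six common neighbours is \<open>x\<close> itself, which is outside
      the local graph.\<close>
    moreover have "x \<in> N u \<inter> N v" using uv N_sym by blast
    ultimately have "card (N u \<inter> N v - {x}) = 5" by simp
    moreover have "card (N x \<inter> N u \<inter> (N x \<inter> N v)) \<le> card (N u \<inter> N v - {x})"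
      using N_irrefl by (intro card_mono) auto
    ultimately show ?thesis using uv by simp
  qed
  have ins: "insert x K \<subseteq> V" "\<And>u v. \<lbrakk>u \<in> insert x K; v \<in> insert x K; u \<noteq> v\<rbrakk> \<Longrightarrow> v \<in> N u"
    "card (insert x K) = Suc (card K)" "finite K" "x \<notin> K"
    if K: "K \<subseteq> N x" "\<And>u v. \<lbrakk>u \<in> K; v \<in> K; u \<noteq> v\<rbrakk> \<Longrightarrow> v \<in> (if u \<in> N x then N x \<inter> N u else {})" for K
  proof -
    show "insert x K \<subseteq> V" using K(1) x NV by auto
    show f: "finite K" using K(1) finite_subset finite_N by blast
    show xK: "x \<notin> K" using K(1) N_irrefl by auto
    then show "card (insert x K) = Suc (card K)" using f by simp
    show "v \<in> N u" if "u \<in> insert x K" "v \<in> insert x K" "u \<noteq> v" for u v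
      using that K adj N_sym[of u v] by blast
  qed
  show "card K \<le> 20"
    if K: "K \<subseteq> N x" "\<And>u v. \<lbrakk>u \<in> K; v \<in> K; u \<noteq> v\<rbrakk> \<Longrightarrow> v \<in> (if u \<in> N x then N x \<inter> N u else {})" for K
    using clique_card_le_21[OF ins(1)[OF K] _ ins(2)[OF K]] ins(3)[OF K] by simp
  show "card ((if w \<in> N x then N x \<inter> N w else {}) \<inter> K) = 2"
    if K: "K \<subseteq> N x" "\<And>u v. \<lbrakk>u \<in> K; v \<in> K; u \<noteq> v\<rbrakk> \<Longrightarrow> v \<in> (if u \<in> N x then N x \<inter> N u else {})"
      and 20: "card K = 20" and w: "w \<in> N x - K" for K w
  proof -
    note [simp] = ins(4)[OF K]
    have "0 = (\<Sum>y\<in>insert x K. cosine (\<delta> y w))"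
      using clique_21_tight[OF ins(1)[OF K] _ ins(2)[OF K], of w] ins(3)[OF K] 20 w NV by auto
    also have "\<dots> = cosine (\<delta> x w) + (\<Sum>y\<in>K. cosine (\<delta> y w))" using ins(5)[OF K] by simp
    also have "cosine (\<delta> x w) = - 1 / 20" using w by (auto simp: N_iff cosine_def)
    also have "(\<Sum>y\<in>K. cosine (\<delta> y w)) = (\<Sum>y\<in>K. if y \<in> N w then - 1 / 20 else 1 / 120)"
    proof (intro sum.cong refl)
      fix y assume y: "y \<in> K"
      show "cosine (\<delta> y w) = (if y \<in> N w then - 1 / 20 else 1 / 120)"
      proof (cases "y \<in> N w")
        case True
        then have "\<delta> y w = 1" using N_sym by (auto simp: N_iff)
        then show ?thesis using True by (simp add: cosine_def)
      next
        case False
        then have "\<delta> y w = 2" using dist2[of y w] y w K(1) N_sym by blast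
        then show ?thesis using False by (simp add: cosine_def)
      qed
    qed
    also have "\<dots> = - real (card (N w \<inter> K)) / 20 + real (card (K - N w)) / 120"
      by (simp add: sum.If_cases Int_commute Diff_eq)
    also have "card (K - N w) = 20 - card (N w \<inter> K)"
      using 20 by (simp add: card_Diff_subset_Int Int_commute)
    also have "real (20 - card (N w \<inter> K)) = 20 - real (card (N w \<inter> K))"
      using card_mono[of K "N w \<inter> K"] 20 by (simp add: of_nat_diff)
    \<comment> \<open>With n neighbours of \<open>w\<close> in \<open>K\<close> the equation is
      -1/20 - n/20 + (20 - n)/120 = 0, that is, 7 n = 14.\<close>
    finally have "real (card (N w \<inter> K)) = 2" by (simp add: field_simps)
    then have "card (N w \<inter> K) = 2" by simp
    moreover have "N x \<inter> N w \<inter> K = N w \<inter> K" using K(1) by auto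
    ultimately show ?thesis using w by simp
  qed
qed

end

section \<open>Distances as numbers of steps\<close>

context wf_digraph
begin

lemma awalk_cost_1: "awalk_cost (\<lambda>_. 1) p = real (length p)"
  by (simp add: awalk_cost_def sum_list_triv)

text \<open>Membership of \<open>u\<close> matters for n = 0, where the relation power is the
  identity on the whole type.\<close>

lemma ex_awalk_length_iff_relpow:
  "(\<exists>p. awalk u p v \<and> length p = n) \<longleftrightarrow> u \<in> verts G \<and> (u, v) \<in> arcs_ends G ^^ n"
proof (induction n arbitrary: u)
  case 0
  then show ?case by (auto simp: awalk_Nil_iff)
next
  case (Suc n)
  have "(\<exists>p. awalk u p v \<and> length p = Suc n) \<longleftrightarrow> (\<exists>e p. awalk u (e # p) v \<and> length p = n)"
    by (auto simp: length_Suc_conv)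
  also have "\<dots> \<longleftrightarrow> (\<exists>e \<in> arcs G. tail G e = u \<and> (\<exists>p. awalk (head G e) p v \<and> length p = n))"
    by (auto simp: awalk_Cons_iff)
  also have "\<dots> \<longleftrightarrow> (\<exists>w. (u, w) \<in> arcs_ends G \<and> (w, v) \<in> arcs_ends G ^^ n)"
    unfolding Suc.IH by (force simp: arcs_ends_conv)
  also have "\<dots> \<longleftrightarrow> u \<in> verts G \<and> (u, v) \<in> arcs_ends G ^^ Suc n"
    using adj_in_verts(1) relpow_Suc_I2 relpow_Suc_D2 by metis
  finally show ?case .
qed

definition hops :: "'a \<Rightarrow> 'a \<Rightarrow> nat" where
  "hops u v = (LEAST n. (u, v) \<in> arcs_ends G ^^ n)"

text \<open>The infimum over walks is attained by a walk of the least possible length.\<close>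

lemma graph_distance_eq_hops:
  assumes "u \<in> verts G" "(u, v) \<in> arcs_ends G ^^ n"
  shows "graph_distance G u v = ereal (real (hops u v))"
proof -
  have h: "(u, v) \<in> arcs_ends G ^^ hops u v"
    unfolding hops_def using assms(2) by (rule LeastI)
  have "hops u v \<le> length p" if "awalk u p v" for p
    unfolding hops_def using ex_awalk_length_iff_relpow that by (intro Least_le) blast
  moreover obtain p where "awalk u p v" "length p = hops u v"
    using h assms(1) ex_awalk_length_iff_relpow by blast
  ultimately show ?thesis
    unfolding graph_distance_def \<mu>_def awalk_cost_1
    by (intro antisym INF_lower2[of p] INF_greatest) auto
qed

lemma hops_le: "(u, v) \<in> arcs_ends G ^^ n \<Longrightarrow> hops u v \<le> n"
  unfolding hops_def by (rule Least_le)

end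

section \<open>Transfer to the given distance-regular graph\<close>

theorem proposition5p5:
  fixes \<Gamma> :: "('a, 'b) pre_digraph" and x :: 'a
  assumes "distance_regular \<Gamma> [80, 54, 12] [1, 6, 60]"
    and "x \<in> verts \<Gamma>"
  shows "\<exists>C :: 'a set set. card C = 4 \<and> pairwise disjnt C \<and>
           (\<forall>K \<in> C. clique_in (local_graph \<Gamma> x) K \<and> card K = 20)"
proof -
  let ?V = "verts \<Gamma>"
  interpret graph \<Gamma> using assms(1) by (simp add: distance_regular_def)
  have conn: "connected \<Gamma>" and diam: "graph_diameter \<Gamma> = 3"
    using assms(1) by (auto simp: distance_regular_def)
  have dr: "card {z \<in> neighbours \<Gamma> y. graph_distance \<Gamma> x z = ereal (real i - 1)} = [0, 1, 6, 60] ! i"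
    "card {z \<in> neighbours \<Gamma> y. graph_distance \<Gamma> x z = ereal (real i + 1)} = [80, 54, 12, 0] ! i"
    if "x \<in> ?V" "y \<in> ?V" "graph_distance \<Gamma> x y = ereal (real i)" "i \<le> 3" for x y i
    using assms(1) that unfolding distance_regular_def by auto
  define N where "N u = (if u \<in> ?V then neighbours \<Gamma> u else {})" for u
  have N_iff_adj: "v \<in> N u \<longleftrightarrow> (u, v) \<in> arcs_ends \<Gamma>" for u v
    by (auto simp: N_def neighbours_def adj_in_verts)
  have reach: "(u, v) \<in> arcs_ends \<Gamma> ^^ hops u v" if "u \<in> ?V" "v \<in> ?V" for u v
  proof -
    have "u \<rightarrow>\<^sup>*\<^bsub>\<Gamma>\<^esub> v"
      using symmetric_connected_imp_strongly_connected[OF sym_arcs conn] that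
      by (auto simp: strongly_connected_def)
    then have "\<exists>n. (u, v) \<in> arcs_ends \<Gamma> ^^ n"
      by (auto dest: reachable_rtranclI simp: rtrancl_power)
    then show ?thesis unfolding hops_def by (rule LeastI_ex)
  qed
  have dist: "graph_distance \<Gamma> u v = ereal (real (hops u v))" if "u \<in> ?V" "v \<in> ?V" for u v
    using graph_distance_eq_hops[OF that(1) reach[OF that]] .
  have adj_sym: "(v, u) \<in> arcs_ends \<Gamma>" if "(u, v) \<in> arcs_ends \<Gamma>" for u v
    using arcs_ends_symmetric[OF sym_arcs that] .
  have relpow_sym: "(v, u) \<in> arcs_ends \<Gamma> ^^ n" if "(u, v) \<in> arcs_ends \<Gamma> ^^ n" for u v n
    using that
  proof (induction n arbitrary: v)
    case (Suc n)
    then obtain w where "(u, w) \<in> arcs_ends \<Gamma> ^^ n" "(w, v) \<in> arcs_ends \<Gamma>" by auto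
    then show ?case using Suc.IH adj_sym by (blast intro: relpow_Suc_I2)
  qed auto
  have hops_0: "hops u v = 0 \<longleftrightarrow> u = v" if "u \<in> ?V" "v \<in> ?V" for u v
    using reach[OF that] hops_le[of u v 0] by auto
  have V_if_N: "u \<in> ?V \<and> v \<in> ?V" if "v \<in> N u" for u v
    using that by (auto simp: N_iff_adj adj_in_verts)
  interpret drg_80_54_12 ?V N hops
  proof
    show "finite ?V" by simp
    show "v \<in> N u \<longleftrightarrow> u \<in> ?V \<and> v \<in> ?V \<and> hops u v = 1" for u v
    proof
      assume v: "v \<in> N u"
      then have "hops u v \<le> 1" using hops_le[of u v 1] by (simp add: N_iff_adj)
      moreover have "u \<noteq> v" using v adj_not_same by (auto simp: N_iff_adj)
      then have "hops u v \<noteq> 0" using hops_0 V_if_N[OF v] by blast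
      ultimately show "u \<in> ?V \<and> v \<in> ?V \<and> hops u v = 1" using V_if_N[OF v] by simp
    next
      assume "u \<in> ?V \<and> v \<in> ?V \<and> hops u v = 1"
      then show "v \<in> N u" using reach[of u v] by (simp add: N_iff_adj)
    qed
    show "hops u v = hops v u" if "u \<in> ?V" "v \<in> ?V" for u v
      using reach[OF that] reach[OF that(2,1)] hops_le relpow_sym by (meson antisym)
    show "hops u v = 0 \<longleftrightarrow> u = v" if "u \<in> ?V" "v \<in> ?V" for u v
      using hops_0[OF that] .
    show le3: "hops u v \<le> 3" if "u \<in> ?V" "v \<in> ?V" for u v
    proof -
      \<comment> \<open>The diameter is a supremum of distances, and here it equals 3.\<close>
      have "graph_distance \<Gamma> u v \<le> graph_diameter \<Gamma>"
        unfolding graph_diameter_def using that by (intro SUP_upper2[of u] SUP_upper2[of v]) auto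
      then show ?thesis by (simp add: diam dist[OF that])
    qed
    show "hops u w \<le> Suc (hops u v)" if "u \<in> ?V" "w \<in> N v" for u v w
    proof -
      have "(u, w) \<in> arcs_ends \<Gamma> ^^ Suc (hops u v)"
        using reach[of u v] that V_if_N[OF that(2)] by (auto simp: N_iff_adj)
      then show ?thesis by (rule hops_le)
    qed
    show "card {w \<in> N v. Suc (hops u w) = hops u v} = [0, 1, 6, 60] ! hops u v"
      if "u \<in> ?V" "v \<in> ?V" for u v
    proof -
      have "{w \<in> N v. Suc (hops u w) = hops u v}
          = {w \<in> neighbours \<Gamma> v. graph_distance \<Gamma> u w = ereal (real (hops u v) - 1)}"
        using that by (auto simp: N_def neighbours_def dist)
      then show ?thesis using dr(1)[OF that dist[OF that] le3[OF that]] by simp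
    qed
    show "card {w \<in> N v. hops u w = Suc (hops u v)} = [80, 54, 12, 0] ! hops u v"
      if "u \<in> ?V" "v \<in> ?V" for u v
    proof -
      have "{w \<in> N v. hops u w = Suc (hops u v)}
          = {w \<in> neighbours \<Gamma> v. graph_distance \<Gamma> u w = ereal (real (hops u v) + 1)}"
        using that by (auto simp: N_def neighbours_def dist)
      then show ?thesis using dr(2)[OF that dist[OF that] le3[OF that]] by simp
    qed
  qed
  interpret loc: local_graph_80 "N x" "\<lambda>y. if y \<in> N x then N x \<inter> N y else {}"
    using local_graph[OF assms(2)] .
  obtain C where C: "card C = 4" "pairwise disjnt C" "\<And>K. K \<in> C \<Longrightarrow> loc.clique K \<and> card K = 20"
    using loc.four_cliques by blast
  have "clique_in (local_graph \<Gamma> x) K" if "loc.clique K" for K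
    unfolding clique_in_def pairwise_def
  proof (intro conjI ballI impI)
    have "verts (local_graph \<Gamma> x) = N x" using assms(2) by (simp add: local_graph_def N_def)
    then show "K \<subseteq> verts (local_graph \<Gamma> x)" using that by (simp add: loc.clique_def)
    fix u v assume uv: "u \<in> K" "v \<in> K" "u \<noteq> v"
    then have "u \<in> N x" "v \<in> N x" "v \<in> N u"
      using that by (auto simp: loc.clique_def split: if_splits)
    moreover then obtain e where "e \<in> arcs \<Gamma>" "tail \<Gamma> e = u" "head \<Gamma> e = v"
      by (auto simp: N_iff_adj)
    \<comment> \<open>The local graph is induced, so it keeps the arc \<open>e\<close>, both of
      whose ends are neighbours of \<open>x\<close>.\<close>
    ultimately show "u \<rightarrow>\<^bsub>local_graph \<Gamma> x\<^esub> v"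
      using assms(2) by (force simp: local_graph_def arcs_ends_conv N_def)
  qed
  then show ?thesis using C by blast
qed

end
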